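(* Let $n\ge 1$, $d\geq 1$, and let the cyclic group $\mathbb Z_n$ with (multiplicative) generator $\tau$ act on $S^1\times\Delta_{n-1}(d)$ via $$\tau(e^{i\theta},s_1,\ldots,s_n)=(e^{i\theta+i2\pi s_1},s_2,\ldots,s_n,s_1).$$ Then the quotient of $S^1\times \Delta_{n-1}(d)$ by this action is homeomorphic to $B^d(S^1,n)$. When $d=1$, there is an $\mathfrak S_n$-equivariant homeomorphism $$F(S^1,n)\cong (S^1\times\mathring{\Delta}_{n-1})\times_{\mathbb Z_n}\mathfrak S_n .$$
   Context: $S^1$ is the unit circle in $\mathbb C$. $\Delta_{n-1}=\{(s_1,\ldots,s_n): 0\leq s_i\leq 1,\ \sum s_i=1\}$, and $\mathring\Delta_{n-1}$ is the open simplex (all $s_i>0$). $\Delta_{n-1}(d)\subset\Delta_{n-1}$ is the subspace of points for which at most $d-1$ cyclically consecutive $s_i$'s vanish ($s_n$ and $s_1$ are considered consecutive); thus $\Delta_{n-1}(1)=\mathring\Delta_{n-1}$. For a space $X$, $\Delta^d(X,n)\subset X^n$ is the subspace of tuples in which no $d+1$ entries (at distinct positions) are equal, $B^d(X,n)=\Delta^d(X,n)/\mathfrak S_n$ with $\mathfrak S_n$ permuting coordinates, and $F(X,n)=\Delta^1(X,n)$ is the space of $n$-tuples of pairwise distinct points. In the last formula, $(S^1\times\mathring{\Delta}_{n-1})\times_{\mathbb Z_n}\mathfrak S_n$ is the quotient of $S^1\times\mathring\Delta_{n-1}\times\mathfrak S_n$ by the $\mathbb Z_n$-action in which $\tau$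 acts on $S^1\times\mathring\Delta_{n-1}$ by $\tau(e^{i\theta},s_1,\ldots,s_n)=(e^{i\theta+i2\pi s_1},s_2,\ldots,s_n,s_1)$ and on $\mathfrak S_n$ by $\sigma\mapsto\sigma\circ c$, where $c=(1\,2\,\cdots\,n)$; $\mathfrak S_n$ acts on it by left multiplication on the $\mathfrak S_n$ factor, and acts on $F(S^1,n)$ by permuting coordinates, $(g\cdot x)_{g(i)}=x_i$. *)

theory Defs
  imports
    "HOL-Analysis.Analysis"
    "HOL-Algebra.Group_Action"
    "HOL-Algebra.Sym_Groups"
    "HOL-Algebra.Elementary_Groups"
begin

section \<open>Orbit spaces\<close>

text \<open>
  Actions are given by plain functions \<open>\<phi> g\<close>, which only matter on \<^term>\<open>topspace X\<close>;
  \<^locale>\<open>group_action\<close> wants them extensional, hence the restriction in the lemmas below.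
\<close>

definition orbit_space ::
    "('g, 'm) monoid_scheme \<Rightarrow> ('g \<Rightarrow> 'a \<Rightarrow> 'a) \<Rightarrow> 'a topology \<Rightarrow> 'a set topology" where
  "orbit_space G \<phi> X =
     topology (\<lambda>U. U \<subseteq> orbits G (topspace X) \<phi> \<and> openin X {x \<in> topspace X. orbit G \<phi> x \<in> U})"

lemma openin_orbit_space:
  "openin (orbit_space G \<phi> X) U \<longleftrightarrow>
     U \<subseteq> orbits G (topspace X) \<phi> \<and> openin X {x \<in> topspace X. orbit G \<phi> x \<in> U}"
proof -
  let ?L = "\<lambda>U. U \<subseteq> orbits G (topspace X) \<phi> \<and> openin X {x \<in> topspace X. orbit G \<phi> x \<in> U}"
  have "istopology ?L"
    unfolding istopology_def
  proof (intro conjI allI impI)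
    fix S T assume S: "?L S" and T: "?L T"
    have "{x \<in> topspace X. orbit G \<phi> x \<in> S \<inter> T} =
        {x \<in> topspace X. orbit G \<phi> x \<in> S} \<inter> {x \<in> topspace X. orbit G \<phi> x \<in> T}"
      by auto
    then show "openin X {x \<in> topspace X. orbit G \<phi> x \<in> S \<inter> T}"
      using S T by auto
    show "S \<inter> T \<subseteq> orbits G (topspace X) \<phi>"
      using S by auto
  next
    fix K assume K: "\<forall>S\<in>K. ?L S"
    have "{x \<in> topspace X. orbit G \<phi> x \<in> \<Union>K} =
        (\<Union>S\<in>K. {x \<in> topspace X. orbit G \<phi> x \<in> S})"
      by auto
    then show "openin X {x \<in> topspace X. orbit G \<phi> x \<in> \<Union>K}"
      using K by auto
    show "\<Union>K \<subseteq> orbits G (topspace X) \<phi>"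
      using K by blast
  qed
  then show ?thesis
    by (simp add: orbit_space_def)
qed

lemma topspace_orbit_space: "topspace (orbit_space G \<phi> X) = orbits G (topspace X) \<phi>"
proof
  show "topspace (orbit_space G \<phi> X) \<subseteq> orbits G (topspace X) \<phi>"
    using openin_orbit_space openin_topspace by blast
  have "{x \<in> topspace X. orbit G \<phi> x \<in> orbits G (topspace X) \<phi>} = topspace X"
    by (auto simp: orbits_def)
  then have "openin (orbit_space G \<phi> X) (orbits G (topspace X) \<phi>)"
    by (simp add: openin_orbit_space)
  then show "orbits G (topspace X) \<phi> \<subseteq> topspace (orbit_space G \<phi> X)"
    by (rule openin_subset)
qed

lemma quotient_map_orbit_space: "quotient_map X (orbit_space G \<phi> X) (orbit G \<phi>)"
  unfolding quotient_map_def
  by (auto simp: topspace_orbit_space openin_orbit_space orbits_def)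

lemma group_action_restrictI:
  assumes "group G"
    and maps: "\<And>g x. g \<in> carrier G \<Longrightarrow> x \<in> E \<Longrightarrow> \<phi> g x \<in> E"
    and one: "\<And>x. x \<in> E \<Longrightarrow> \<phi> \<one>\<^bsub>G\<^esub> x = x"
    and mult: "\<And>g h x. g \<in> carrier G \<Longrightarrow> h \<in> carrier G \<Longrightarrow> x \<in> E \<Longrightarrow>
                 \<phi> (g \<otimes>\<^bsub>G\<^esub> h) x = \<phi> g (\<phi> h x)"
  shows "group_action G E (\<lambda>g. restrict (\<phi> g) E)"
proof -
  interpret group G by fact
  have bij: "bij_betw (\<phi> g) E E" if g: "g \<in> carrier G" for g
  proof (rule bij_betwI[where g = "\<phi> (inv\<^bsub>G\<^esub> g)"])
    show "\<phi> g \<in> E \<rightarrow> E" "\<phi> (inv\<^bsub>G\<^esub> g) \<in> E \<rightarrow> E"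
      using maps g by auto
    show "\<phi> (inv\<^bsub>G\<^esub> g) (\<phi> g x) = x" if "x \<in> E" for x
      using that g mult[of "inv\<^bsub>G\<^esub> g" g x] one by simp
    show "\<phi> g (\<phi> (inv\<^bsub>G\<^esub> g) x) = x" if "x \<in> E" for x
      using that g mult[of g "inv\<^bsub>G\<^esub> g" x] one by simp
  qed
  have Bij: "restrict (\<phi> g) E \<in> Bij E" if "g \<in> carrier G" for g
    using bij[OF that] by (simp add: Bij_def cong: bij_betw_cong)
  show ?thesis
    unfolding group_action_def
  proof (intro group_hom.intro group_hom_axioms.intro homI)
    fix g h assume "g \<in> carrier G" "h \<in> carrier G"
    moreover from this have "restrict (\<phi> g) E \<otimes>\<^bsub>BijGroup E\<^esub> restrict (\<phi> h) E =
        compose E (restrict (\<phi> g) E) (restrict (\<phi> h) E)"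
      by (simp add: BijGroup_def Bij)
    ultimately show "restrict (\<phi> (g \<otimes>\<^bsub>G\<^esub> h)) E =
        restrict (\<phi> g) E \<otimes>\<^bsub>BijGroup E\<^esub> restrict (\<phi> h) E"
      using maps by (auto simp: compose_def restrict_def mult fun_eq_iff)
  qed (use Bij in \<open>auto simp: BijGroup_def intro: group_BijGroup[unfolded BijGroup_def] is_group\<close>)
qed

text \<open>The action of \<open>\<int>\<^sub>n\<close> whose generator acts by \<open>t\<close>.\<close>

definition cyclic_act :: "('a \<Rightarrow> 'a) \<Rightarrow> int \<Rightarrow> 'a \<Rightarrow> 'a" where
  "cyclic_act t k = t ^^ nat k"

lemma group_action_cyclic_act:
  assumes "n \<ge> 1" and maps: "\<And>x. x \<in> E \<Longrightarrow> t x \<in> E"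
    and period: "\<And>x. x \<in> E \<Longrightarrow> (t ^^ n) x = x"
  shows "group_action (integer_mod_group n) E (\<lambda>k. restrict (cyclic_act t k) E)"
proof (rule group_action_restrictI)
  have maps': "(t ^^ k) x \<in> E" if "x \<in> E" for k x
    using that maps by (induction k) auto
  then show "cyclic_act t k x \<in> E" if "x \<in> E" for k x
    using that by (simp add: cyclic_act_def)
  fix k l x assume k: "k \<in> carrier (integer_mod_group n)" and l: "l \<in> carrier (integer_mod_group n)"
    and x: "x \<in> E"
  then have kl: "0 \<le> k" "k < int n" "0 \<le> l" "l < int n"
    using \<open>n \<ge> 1\<close> by (auto simp: carrier_integer_mod_group)
  have eq: "(t ^^ nat k) ((t ^^ nat l) x) = (t ^^ (nat k + nat l)) x"
    by (simp add: funpow_add)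
  show "cyclic_act t (k \<otimes>\<^bsub>integer_mod_group n\<^esub> l) x = cyclic_act t k (cyclic_act t l x)"
  proof (cases "k + l < int n")
    case True
    then show ?thesis
      using kl eq by (simp add: cyclic_act_def nat_add_distrib)
  next
    case False
    then have "(k + l) mod int n = k + l - int n"
      using kl by (smt (verit) minus_mod_self2 mod_pos_pos_trivial)
    moreover have "nat k + nat l = nat (k + l - int n) + n"
      using kl False by linarith
    ultimately show ?thesis
      using eq period[OF x] by (simp add: cyclic_act_def funpow_add)
  qed
qed (auto simp: cyclic_act_def)


section \<open>Tuples with bounded multiplicities\<close>

text \<open>An \<open>n\<close>-tuple is an extensional function on \<open>{1..n}\<close>.\<close>

definition mult_space :: "nat \<Rightarrow> 'a topology \<Rightarrow> nat \<Rightarrow> (nat \<Rightarrow> 'a) topology" where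
  "mult_space d X n = subtopology (product_topology (\<lambda>_. X) {1..n})
     {x. \<not> (\<exists>I \<subseteq> {1..n}. card I = d + 1 \<and> (\<forall>i\<in>I. \<forall>j\<in>I. x i = x j))}"

definition perm_act :: "nat \<Rightarrow> (nat \<Rightarrow> nat) \<Rightarrow> (nat \<Rightarrow> 'a) \<Rightarrow> (nat \<Rightarrow> 'a)" where
  "perm_act n g x = (\<lambda>i\<in>{1..n}. x ((inv\<^bsub>sym_group n\<^esub> g) i))"

definition unordered_mult_space :: "nat \<Rightarrow> 'a topology \<Rightarrow> nat \<Rightarrow> (nat \<Rightarrow> 'a) set topology" where
  "unordered_mult_space d X n = orbit_space (sym_group n) (perm_act n) (mult_space d X n)"

abbreviation conf_space :: "'a topology \<Rightarrow> nat \<Rightarrow> (nat \<Rightarrow> 'a) topology" where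
  "conf_space \<equiv> mult_space 1"

lemma topspace_conf_space:
  "topspace (conf_space X n) = {x \<in> {1..n} \<rightarrow>\<^sub>E topspace X. inj_on x {1..n}}"
proof -
  have "(\<exists>I \<subseteq> {1..n}. card I = 2 \<and> (\<forall>i\<in>I. \<forall>j\<in>I. x i = x j)) \<longleftrightarrow> \<not> inj_on x {1..n}"
    for x :: "nat \<Rightarrow> 'a"
  proof
    assume "\<not> inj_on x {1..n}"
    then obtain i j where "i \<in> {1..n}" "j \<in> {1..n}" "i \<noteq> j" "x i = x j"
      by (auto simp: inj_on_def)
    then show "\<exists>I \<subseteq> {1..n}. card I = 2 \<and> (\<forall>i\<in>I. \<forall>j\<in>I. x i = x j)"
      by (intro exI[of _ "{i, j}"]) auto
  next
    assume "\<exists>I \<subseteq> {1..n}. card I = 2 \<and> (\<forall>i\<in>I. \<forall>j\<in>I. x i = x j)"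
    then obtain I where I: "I \<subseteq> {1..n}" "card I = 2" "\<forall>i\<in>I. \<forall>j\<in>I. x i = x j"
      by blast
    then obtain i j where "I = {i, j}" "i \<noteq> j"
      by (meson card_2_iff)
    then show "\<not> inj_on x {1..n}"
      using I by (meson inj_on_def insertI1 insertI2 subsetD)
  qed
  then show ?thesis
    unfolding mult_space_def topspace_subtopology topspace_product_topology one_add_one by blast
qed

lemma sym_group_inv_apply:
  assumes "g permutes {1..n}"
  shows "(inv\<^bsub>sym_group n\<^esub> g) (g i) = i"
proof -
  have "(inv\<^bsub>sym_group n\<^esub> g) \<circ> g = id"
    using group.l_inv[OF sym_group_is_group[of n], of g] assms
    by (simp add: sym_group_carrier sym_group_mult sym_group_one)
  then show ?thesis
    by (simp add: fun_eq_iff)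
qed

lemma perm_act_apply:
  assumes "g permutes {1..n}" and "i \<in> {1..n}"
  shows "perm_act n g x (g i) = x i"
  using assms by (auto simp: perm_act_def sym_group_inv_apply dest: permutes_in_image)

lemma group_action_perm_act:
  "group_action (sym_group n) (topspace (mult_space d X n))
     (\<lambda>g. restrict (perm_act n g) (topspace (mult_space d X n)))"
proof (rule group_action_restrictI)
  interpret group "sym_group n" by (rule sym_group_is_group)
  show "group (sym_group n)" by (rule sym_group_is_group)
  fix g x assume g: "g \<in> carrier (sym_group n)" and x: "x \<in> topspace (mult_space d X n)"
  define h where "h = inv\<^bsub>sym_group n\<^esub> g"
  have h: "h permutes {1..n}"
    using g unfolding h_def by (metis inv_closed sym_group_carrier)
  have "False" if I: "I \<subseteq> {1..n}" "card I = d + 1"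
    and eq: "\<forall>i\<in>I. \<forall>j\<in>I. perm_act n g x i = perm_act n g x j" for I
  proof -
    have "h ` I \<subseteq> {1..n}"
      using I(1) permutes_in_image[OF h] by blast
    moreover have "card (h ` I) = d + 1"
      using I(2) card_image[OF inj_on_subset[OF permutes_inj[OF h]]] by simp
    moreover have "\<forall>i\<in>h ` I. \<forall>j\<in>h ` I. x i = x j"
    proof (intro ballI, elim imageE)
      fix a b i j assume "a = h i" "b = h j" and ij: "i \<in> I" "j \<in> I"
      moreover have "i \<in> {1..n}" "j \<in> {1..n}"
        using ij I(1) by blast+
      moreover have "perm_act n g x i = perm_act n g x j"
        using ij eq by blast
      ultimately show "x a = x b"
        by (simp add: perm_act_def h_def)
    qed
    moreover have "\<not> (\<exists>I \<subseteq> {1..n}. card I = d + 1 \<and> (\<forall>i\<in>I. \<forall>j\<in>I. x i = x j))"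
      using x by (simp only: mult_space_def topspace_subtopology Int_iff mem_Collect_eq not_False_eq_True)
    ultimately show False
      by blast
  qed
  moreover have "perm_act n g x \<in> {1..n} \<rightarrow>\<^sub>E topspace X"
  proof -
    have "x i \<in> topspace X" if "i \<in> {1..n}" for i
      using x that unfolding mult_space_def topspace_subtopology topspace_product_topology by blast
    then show ?thesis
      unfolding perm_act_def h_def[symmetric]
      using permutes_in_image[OF h] by (simp only: restrict_PiE_iff) blast
  qed
  ultimately show "perm_act n g x \<in> topspace (mult_space d X n)"
    unfolding mult_space_def topspace_subtopology topspace_product_topology by blast
next
  interpret group "sym_group n" by (rule sym_group_is_group)
  fix x assume "x \<in> topspace (mult_space d X n)"
  then have "x \<in> extensional {1..n}"
    by (auto simp: mult_space_def PiE_def)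
  moreover have "inv\<^bsub>sym_group n\<^esub> \<one>\<^bsub>sym_group n\<^esub> = id"
    using inv_one by (simp add: sym_group_one)
  ultimately show "perm_act n \<one>\<^bsub>sym_group n\<^esub> x = x"
    unfolding perm_act_def by (simp only: id_apply extensional_restrict)
next
  interpret group "sym_group n" by (rule sym_group_is_group)
  fix g h x assume g: "g \<in> carrier (sym_group n)" and h: "h \<in> carrier (sym_group n)"
  have "inv\<^bsub>sym_group n\<^esub> g permutes {1..n}"
    using g by (metis inv_closed sym_group_carrier)
  then have "(inv\<^bsub>sym_group n\<^esub> g) i \<in> {1..n}" if "i \<in> {1..n}" for i
    using that permutes_in_image by metis
  moreover have "inv\<^bsub>sym_group n\<^esub> (g \<otimes>\<^bsub>sym_group n\<^esub> h) =
      (inv\<^bsub>sym_group n\<^esub> h) \<circ> (inv\<^bsub>sym_group n\<^esub> g)"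
    using inv_mult_group[OF g h] by (simp add: sym_group_mult)
  ultimately show "perm_act n (g \<otimes>\<^bsub>sym_group n\<^esub> h) x = perm_act n g (perm_act n h x)"
    unfolding perm_act_def by (intro restrict_ext) (simp only: comp_apply restrict_apply if_True)
qed


section \<open>Simplices and the cyclic action\<close>

abbreviation circle :: "complex topology" where
  "circle \<equiv> top_of_set (sphere 0 1)"

text \<open>The cycle \<open>(1 2 \<dots> n)\<close>.\<close>

definition cyc :: "nat \<Rightarrow> nat \<Rightarrow> nat" where
  "cyc n = cycle_of_list [1..<Suc n]"

lemma cyc_apply:
  assumes "i \<in> {1..n}"
  shows "cyc n i = (if i = n then 1 else Suc i)"
proof -
  let ?l = "[1..<Suc n]"
  have "map (cyc n) ?l = rotate1 ?l"
    using cyclic_rotation[of ?l 1] by (simp add: cyc_def del: upt_Suc)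
  then have "map (cyc n) ?l ! (i - 1) = rotate1 ?l ! (i - 1)"
    by simp
  moreover have "map (cyc n) ?l ! (i - 1) = cyc n i"
    using assms by (subst nth_map) (auto simp del: upt_Suc)
  moreover have "rotate1 ?l ! (i - 1) = ?l ! (Suc (i - 1) mod n)"
    using assms by (subst nth_rotate1) (auto simp del: upt_Suc)
  ultimately show ?thesis
    using assms by (auto simp del: upt_Suc)
qed

lemma cyc_permutes: "cyc n permutes {1..n}"
  using cycle_permutes[of "[1..<Suc n]"]
  by (simp add: cyc_def atLeastLessThanSuc_atLeastAtMost del: upt_Suc)

lemma cyc_funpow_n: "cyc n ^^ n = id"
  using cycle_is_id_root[of "[1..<Suc n]"] by (simp add: cyc_def del: upt_Suc)

text \<open>
  \<open>std_simplex n\<close> is \<open>\<Delta>\<^bsub>n-1\<^esub>\<close> (the index counts vertices, not the dimension). In \<open>simplex_bd n d\<close>, the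
  positions \<open>i, cyc n i, \<dots>\<close> (\<open>m\<close> of them) form a run of \<open>m\<close> cyclically consecutive indices.
\<close>

definition std_simplex :: "nat \<Rightarrow> (nat \<Rightarrow> real) set" where
  "std_simplex n = {s \<in> {1..n} \<rightarrow>\<^sub>E {0..1}. (\<Sum>i=1..n. s i) = 1}"

definition open_simplex :: "nat \<Rightarrow> (nat \<Rightarrow> real) set" where
  "open_simplex n = {s \<in> std_simplex n. \<forall>i\<in>{1..n}. s i > 0}"

definition simplex_bd :: "nat \<Rightarrow> nat \<Rightarrow> (nat \<Rightarrow> real) set" where
  "simplex_bd n d = {s \<in> std_simplex n.
     \<forall>i\<in>{1..n}. \<forall>m\<le>n. (\<forall>j<m. s ((cyc n ^^ j) i) = 0) \<longrightarrow> m \<le> d - 1}"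

lemma simplex_bd_1: "simplex_bd n 1 = open_simplex n"
proof -
  have "(\<forall>i\<in>{1..n}. \<forall>m\<le>n. (\<forall>j<m. s ((cyc n ^^ j) i) = 0) \<longrightarrow> m \<le> 0) \<longleftrightarrow>
      (\<forall>i\<in>{1..n}. s i > 0)" (is "?l \<longleftrightarrow> ?r") if s: "s \<in> std_simplex n" for s
  proof
    assume l: ?l
    show ?r
    proof
      fix i assume i: "i \<in> {1..n}"
      then have "s i \<noteq> 0"
        using bspec[OF l i] by (auto dest!: spec[where x = 1])
      moreover have "s i \<ge> 0"
        using s i by (auto simp: std_simplex_def PiE_iff)
      ultimately show "s i > 0" by simp
    qed
  next
    assume r: ?r
    show ?l
    proof (intro ballI allI impI)
      fix i m assume "i \<in> {1..n}" "\<forall>j<m. s ((cyc n ^^ j) i) = 0"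
      then show "m \<le> 0"
        using r by (metis bot_nat_0.not_eq_extremum eq_id_iff funpow_0 le0 less_irrefl order_refl)
    qed
  qed
  then show ?thesis
    unfolding simplex_bd_def open_simplex_def diff_self_eq_0 by blast
qed

definition circle_times :: "nat \<Rightarrow> (nat \<Rightarrow> real) set \<Rightarrow> (complex \<times> (nat \<Rightarrow> real)) topology" where
  "circle_times n S =
     prod_topology circle (subtopology (product_topology (\<lambda>_. euclideanreal) {1..n}) S)"

definition tau :: "nat \<Rightarrow> complex \<times> (nat \<Rightarrow> real) \<Rightarrow> complex \<times> (nat \<Rightarrow> real)" where
  "tau n = (\<lambda>(z, s). (z * exp (\<i> * of_real (2 * pi * s 1)), \<lambda>i\<in>{1..n}. s (cyc n i)))"

definition tau_twisted ::
    "nat \<Rightarrow> (complex \<times> (nat \<Rightarrow> real)) \<times> (nat \<Rightarrow> nat) \<Rightarrow> (complex \<times> (nat \<Rightarrow> real)) \<times> (nat \<Rightarrow> nat)" where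
  "tau_twisted n = (\<lambda>(p, \<sigma>). (tau n p, \<sigma> \<circ> cyc n))"

text \<open>The space \<open>(S\<^sup>1 \<times> S) \<times>\<^bsub>\<int>\<^sub>n\<^esub> \<SS>\<^sub>n\<close>, with \<open>S\<close> the open simplex, and the left action on it.\<close>

definition induced_space ::
    "nat \<Rightarrow> ((complex \<times> (nat \<Rightarrow> real)) \<times> (nat \<Rightarrow> nat)) set topology" where
  "induced_space n = orbit_space (integer_mod_group n) (cyclic_act (tau_twisted n))
     (prod_topology (circle_times n (open_simplex n)) (discrete_topology (carrier (sym_group n))))"

definition left_act ::
    "(nat \<Rightarrow> nat) \<Rightarrow> ((complex \<times> (nat \<Rightarrow> real)) \<times> (nat \<Rightarrow> nat)) set
       \<Rightarrow> ((complex \<times> (nat \<Rightarrow> real)) \<times> (nat \<Rightarrow> nat)) set" where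
  "left_act g A = (\<lambda>(p, \<sigma>). (p, g \<circ> \<sigma>)) ` A"

lemma left_act_orbit:
  "left_act g (orbit (integer_mod_group n) (cyclic_act (tau_twisted n)) (p, \<sigma>)) =
   orbit (integer_mod_group n) (cyclic_act (tau_twisted n)) (p, g \<circ> \<sigma>)"
proof -
  have pow: "(tau_twisted n ^^ k) (p, \<sigma>) = ((tau n ^^ k) p, \<sigma> \<circ> (cyc n ^^ k))" for k \<sigma>
    by (induction k) (auto simp: tau_twisted_def fun_eq_iff funpow_swap1)
  show ?thesis
    by (force simp: left_act_def orbit_def cyclic_act_def pow comp_assoc image_def)
qed

lemma topspace_circle_times:
  assumes "S \<subseteq> std_simplex n"
  shows "topspace (circle_times n S) = sphere 0 1 \<times> S"
proof -
  have "S \<subseteq> {1..n} \<rightarrow>\<^sub>E UNIV"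
    using assms by (auto simp: std_simplex_def PiE_def)
  then show ?thesis
    by (simp add: circle_times_def Int_absorb1 inf.absorb2)
qed

lemma tau_closed_simplex:
  assumes "z \<in> sphere 0 1" and s: "s \<in> std_simplex n"
  shows "tau n (z, s) \<in> sphere 0 1 \<times> std_simplex n"
proof -
  have "(\<Sum>i=1..n. s (cyc n i)) = (\<Sum>i=1..n. s i)"
    using sum.permute[OF cyc_permutes, of s n] by (simp add: comp_def)
  then show ?thesis
    using assms permutes_in_image[OF cyc_permutes, of n]
    by (auto simp: tau_def std_simplex_def norm_mult PiE_iff simp del: atLeastAtMost_iff)
qed

lemma tau_closed:
  assumes "p \<in> sphere 0 1 \<times> simplex_bd n d"
  shows "tau n p \<in> sphere 0 1 \<times> simplex_bd n d"
proof -
  obtain z s where p: "p = (z, s)" "z \<in> sphere 0 1" "s \<in> simplex_bd n d"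
    using assms by auto
  define t where "t = snd (tau n p)"
  have t: "t i = s (cyc n i)" if "i \<in> {1..n}" for i
    using that by (simp add: t_def p tau_def)
  have mem: "(cyc n ^^ j) i \<in> {1..n}" if "i \<in> {1..n}" for i j
    using that permutes_in_image[OF cyc_permutes, of n] by (induction j) auto
  have "m \<le> d - 1" if i: "i \<in> {1..n}" and "m \<le> n" and "\<forall>j<m. t ((cyc n ^^ j) i) = 0" for i m
  proof -
    have "\<forall>j<m. s ((cyc n ^^ j) (cyc n i)) = 0"
      using that t[OF mem[OF i]] by (simp add: funpow_swap1)
    moreover have "cyc n i \<in> {1..n}"
      using mem[OF i, of 1] by simp
    ultimately show ?thesis
      using p(3) \<open>m \<le> n\<close> unfolding simplex_bd_def by blast
  qed
  moreover have "tau n p \<in> sphere 0 1 \<times> std_simplex n"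
    using p tau_closed_simplex by (auto simp: simplex_bd_def)
  ultimately show ?thesis
    unfolding simplex_bd_def t_def by (auto simp: mem_Times_iff)
qed

lemma tau_funpow:
  assumes "s \<in> extensional {1..n}" and "n \<ge> 1" and "k \<le> n"
  shows "(tau n ^^ k) (z, s) =
    (z * exp (\<i> * of_real (2 * pi * (\<Sum>i=1..k. s i))), \<lambda>i\<in>{1..n}. s ((cyc n ^^ k) i))"
  using \<open>k \<le> n\<close>
proof (induction k)
  case 0
  then show ?case
    using assms(1) by (auto simp: extensional_def restrict_def)
next
  case (Suc k)
  have 1: "(cyc n ^^ k) 1 = Suc k" if "k < n" for k
    using that by (induction k) (auto simp: cyc_apply)
  have mem: "cyc n i \<in> {1..n}" if "i \<in> {1..n}" for i
    using that permutes_in_image[OF cyc_permutes, of n] by blast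
  have "exp (\<i> * of_real (2 * pi * (\<Sum>i=1..k. s i))) * exp (\<i> * of_real (2 * pi * s (Suc k))) =
      exp (\<i> * of_real (2 * pi * (\<Sum>i=1..Suc k. s i)))"
    by (simp add: exp_add[symmetric] algebra_simps del: exp_add)
  moreover have "(\<lambda>i\<in>{1..n}. (\<lambda>i\<in>{1..n}. s ((cyc n ^^ k) i)) (cyc n i)) =
      (\<lambda>i\<in>{1..n}. s ((cyc n ^^ Suc k) i))"
    using mem by (auto simp: restrict_def fun_eq_iff funpow_swap1 simp del: atLeastAtMost_iff)
  moreover have "(tau n ^^ Suc k) (z, s) = tau n ((tau n ^^ k) (z, s))"
    by simp
  moreover have "(\<lambda>i\<in>{1..n}. s ((cyc n ^^ k) i)) 1 = s (Suc k)"
    using Suc.prems assms(2) 1[of k] by simp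
  ultimately show ?case
    using Suc.IH[OF Suc_leD[OF Suc.prems]] by (simp only: tau_def case_prod_conv mult.assoc)
qed

lemma tau_funpow_n:
  assumes "p \<in> sphere 0 1 \<times> std_simplex n" and "n \<ge> 1"
  shows "(tau n ^^ n) p = p"
proof -
  obtain z s where p: "p = (z, s)" and s: "s \<in> std_simplex n"
    using assms by auto
  have ext: "s \<in> extensional {1..n}" and sum: "(\<Sum>i=1..n. s i) = 1"
    using s by (auto simp: std_simplex_def PiE_def)
  have "exp (\<i> * of_real (2 * pi)) = 1"
    using exp_two_pi_i by (simp add: mult.commute mult.left_commute)
  then show ?thesis
    unfolding p tau_funpow[OF ext assms(2) order_refl, of z] sum cyc_funpow_n
    using ext by (simp add: extensional_restrict)
qed

lemma group_action_tau:
  assumes "n \<ge> 1"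
  shows "group_action (integer_mod_group n) (topspace (circle_times n (simplex_bd n d)))
    (\<lambda>k. restrict (cyclic_act (tau n) k) (topspace (circle_times n (simplex_bd n d))))"
proof (rule group_action_cyclic_act[OF assms])
  have sub: "simplex_bd n d \<subseteq> std_simplex n"
    by (auto simp: simplex_bd_def)
  fix p assume "p \<in> topspace (circle_times n (simplex_bd n d))"
  then have p: "p \<in> sphere 0 1 \<times> simplex_bd n d"
    by (simp only: topspace_circle_times[OF sub])
  then show "tau n p \<in> topspace (circle_times n (simplex_bd n d))"
    using tau_closed by (simp only: topspace_circle_times[OF sub])
  show "(tau n ^^ n) p = p"
    using p sub assms by (intro tau_funpow_n) auto
qed

lemma group_action_tau_twisted:
  assumes "n \<ge> 1"
  defines "E \<equiv> topspace (prod_topology (circle_times n (open_simplex n))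
                  (discrete_topology (carrier (sym_group n))))"
  shows "group_action (integer_mod_group n) E (\<lambda>k. restrict (cyclic_act (tau_twisted n) k) E)"
proof (rule group_action_cyclic_act[OF assms(1)])
  have sub: "open_simplex n \<subseteq> std_simplex n"
    by (auto simp: open_simplex_def)
  have E: "E = (sphere 0 1 \<times> open_simplex n) \<times> {\<sigma>. \<sigma> permutes {1..n}}"
    unfolding E_def topspace_prod_topology topspace_circle_times[OF sub] topspace_discrete_topology
    by (simp add: sym_group_def)
  fix q assume "q \<in> E"
  then obtain p \<sigma> where q: "q = (p, \<sigma>)" "p \<in> sphere 0 1 \<times> open_simplex n" "\<sigma> permutes {1..n}"
    unfolding E by auto
  show "tau_twisted n q \<in> E"
    using q tau_closed[of p n 1] permutes_compose[OF cyc_permutes q(3)]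
    unfolding E simplex_bd_1 by (simp add: tau_twisted_def)
  have "(tau_twisted n ^^ k) (p, \<sigma>) = ((tau n ^^ k) p, \<sigma> \<circ> (cyc n ^^ k))" for k
    by (induction k) (auto simp: tau_twisted_def fun_eq_iff funpow_swap1)
  moreover have "(tau n ^^ n) p = p"
    using q(2) sub assms by (intro tau_funpow_n) auto
  ultimately show "(tau_twisted n ^^ n) q = q"
    by (simp add: q(1) cyc_funpow_n)
qed

end

theory Submission
  imports Defs
begin

text \<open>
  A pair \<open>(z, s)\<close> gives the points \<open>z e\<^bsup>2\<pi>i(s\<^sub>1+\<dots>+s\<^sub>i\<^sub>-\<^sub>1)\<^esup>\<close>, listed in cyclic order once around
  the circle; \<open>\<tau>\<close> rotates this list, and a run of \<open>m\<close> vanishing \<open>s\<^sub>i\<close> is a point of multiplicity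
  \<open>m + 1\<close>. Every \<open>\<tau>\<close>-orbit has a unique member whose lifted angles are nondecreasing in \<open>[0, 1)\<close>,
  and such a list is determined by its multiset, so unordered configurations correspond to orbits.
  For the topology, adjoin a labelling \<open>\<sigma> \<in> \<SS>\<^sub>n\<close>: the map from
  \<open>S\<^sup>1 \<times> \<Delta>\<^bsub>n-1\<^esub> \<times> \<SS>\<^sub>n\<close> to \<open>(S\<^sup>1)\<^sup>n\<close> is closed by compactness, so its restriction over \<open>\<Delta>\<^sup>d(S\<^sup>1, n)\<close> is a quotient map. Both homeomorphisms compare
  two quotient maps with the same fibres.
\<close>

section \<open>The cyclically ordered points of a pair\<close>

text \<open>The empty sum makes \<open>z\<close> the first point. The last gap \<open>s n\<close> is
  the arc from point \<open>n\<close> back to point 1.\<close>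

definition circle_pts :: "nat \<Rightarrow> complex \<times> (nat \<Rightarrow> real) \<Rightarrow> nat \<Rightarrow> complex" where
  "circle_pts n = (\<lambda>(z, s). \<lambda>i\<in>{1..n}. z * cis (2 * pi * (\<Sum>j=1..<i. s j)))"

section \<open>Iterates of the n-cycle\<close>

lemma cyc_funpow_mem:
  assumes "i \<in> {1..n}"
  shows "(cyc n ^^ k) i \<in> {1..n}"
  using permutes_in_image[OF permutes_funpow[OF cyc_permutes]] assms by blast

lemma cyc_funpow_1:
  assumes "k < n"
  shows "(cyc n ^^ k) 1 = Suc k"
  using assms by (induction k) (auto simp: cyc_apply)

lemma cyc_funpow_add:
  assumes "i \<ge> 1" and "i + k \<le> n"
  shows "(cyc n ^^ k) i = i + k"
  using assms(2)
proof (induction k)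
  case (Suc k)
  then show ?case
    using \<open>i \<ge> 1\<close> by (simp add: cyc_apply)
qed simp

lemma cyc_orbit:
  assumes "i \<in> {1..n}" "j \<in> {1..n}"
  shows "\<exists>k<n. (cyc n ^^ k) i = j"
proof (cases "i \<le> j")
  case True
  then show ?thesis
    using assms cyc_funpow_add[of i "j - i" n] by (intro exI[of _ "j - i"]) auto
next
  case False
  \<comment> \<open>With \<open>j < i\<close> the walk wraps around: \<open>n - i\<close> steps to
    \<open>n\<close>, one step to 1, then \<open>j - 1\<close> steps to \<open>j\<close>. The total
    stays below \<open>n\<close>.\<close>
  have "(cyc n ^^ (j + (n - i))) i = (cyc n ^^ j) ((cyc n ^^ (n - i)) i)"
    by (simp add: funpow_add)
  also have "(cyc n ^^ (n - i)) i = n"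
    using assms cyc_funpow_add[of i "n - i" n] by simp
  also have "(cyc n ^^ j) n = (cyc n ^^ (j - 1)) 1"
    using assms funpow_Suc_right[of "j - 1" "cyc n"] by (simp add: cyc_apply)
  also have "\<dots> = j"
    using assms cyc_funpow_1[of "j - 1" n] by auto
  finally show ?thesis
    using False assms by (intro exI[of _ "j + (n - i)"]) auto
qed

lemma cyc_orbit_image:
  assumes "i \<in> {1..n}"
  shows "(\<lambda>k. (cyc n ^^ k) i) ` {..<n} = {1..n}"
proof
  show "(\<lambda>k. (cyc n ^^ k) i) ` {..<n} \<subseteq> {1..n}"
    using cyc_funpow_mem[OF assms] by blast
  show "{1..n} \<subseteq> (\<lambda>k. (cyc n ^^ k) i) ` {..<n}"
    using cyc_orbit[OF assms] by (force simp del: atLeastAtMost_iff)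
qed

text \<open>The first \<open>n\<close> iterates already cover all \<open>n\<close> indices, so no
  value can repeat.\<close>

lemma inj_on_cyc_orbit:
  assumes "i \<in> {1..n}"
  shows "inj_on (\<lambda>k. (cyc n ^^ k) i) {..<n}"
  using cyc_orbit_image[OF assms] by (intro eq_card_imp_inj_on) simp_all

section \<open>Membership in the simplex\<close>

lemma std_simplex_extensional: "s \<in> std_simplex n \<Longrightarrow> s \<in> extensional {1..n}"
  by (simp add: std_simplex_def PiE_def)

lemma std_simplex_nonneg: "s \<in> std_simplex n \<Longrightarrow> i \<in> {1..n} \<Longrightarrow> s i \<ge> 0"
  by (auto simp: std_simplex_def PiE_iff)

lemma std_simplex_sum: "s \<in> std_simplex n \<Longrightarrow> (\<Sum>i=1..n. s i) = 1"
  by (simp add: std_simplex_def)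

lemma simplex_bd_subset: "simplex_bd n d \<subseteq> std_simplex n"
  by (auto simp: simplex_bd_def)

lemma std_simplexI:
  assumes "s \<in> extensional {1..n}" "\<And>i. i \<in> {1..n} \<Longrightarrow> s i \<ge> 0" "(\<Sum>i=1..n. s i) = 1"
  shows "s \<in> std_simplex n"
proof -
  \<comment> \<open>A nonnegative entry is bounded by the total sum, which is 1.\<close>
  have "s i \<le> 1" if "i \<in> {1..n}" for i
    using member_le_sum[of i "{1..n}" s] assms that by auto
  then show ?thesis
    using assms by (auto simp: std_simplex_def PiE_iff)
qed

lemma tau_funpow_cis:
  assumes "s \<in> extensional {1..n}" and "n \<ge> 1" and "k \<le> n"
  shows "(tau n ^^ k) (z, s) =
    (z * cis (2 * pi * (\<Sum>i=1..k. s i)), \<lambda>i\<in>{1..n}. s ((cyc n ^^ k) i))"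
  using tau_funpow[OF assms] by (simp add: cis_conv_exp)

text \<open>Each application of \<open>tau\<close> moves the base point to the next point of the
  list. Identities between points thus become identities between iterates of
  \<open>tau\<close>.\<close>

lemma circle_pts_conv_tau:
  assumes "s \<in> extensional {1..n}" and "i \<in> {1..n}"
  shows "circle_pts n (z, s) i = fst ((tau n ^^ (i - 1)) (z, s))"
proof -
  have "{1..<i} = {1..i - 1}"
    using assms(2) by auto
  then show ?thesis
    using assms tau_funpow_cis[of s n "i - 1" z] by (auto simp: circle_pts_def)
qed

text \<open>Consecutive points differ by the gap between them. At \<open>i = n\<close> the list
  closes up because the gaps sum to one full turn.\<close>

lemma circle_pts_cyc:
  assumes "z \<in> sphere 0 1" "s \<in> std_simplex n" "i \<in> {1..n}"
  shows "circle_pts n (z, s) (cyc n i) = circle_pts n (z, s) i * cis (2 * pi * s i)"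
proof -
  have 1: "(\<Sum>j=1..<Suc i. s j) = (\<Sum>j=1..<i. s j) + s i"
    using assms(3) by simp
  show ?thesis
  proof (cases "i = n")
    case True
    then have "(\<Sum>j=1..<Suc i. s j) = 1"
      using std_simplex_sum[OF assms(2)] by (simp add: atLeastLessThanSuc_atLeastAtMost)
    then have "(\<Sum>j=1..<i. s j) + s i = 1"
      using 1 by simp
    then have "cis (2 * pi * (\<Sum>j=1..<i. s j)) * cis (2 * pi * s i) = 1"
      by (simp add: cis_mult flip: distrib_left)
    then show ?thesis
      using True assms by (simp add: circle_pts_def cyc_apply mult.assoc)
  next
    case False
    then show ?thesis
      using 1 assms(3) by (simp add: circle_pts_def cyc_apply cis_mult mult.assoc distrib_left)
  qed
qed

text \<open>Both sides are the base point of the \<open>i\<close>-th iterate of \<open>tau\<close>.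
  For \<open>i = n\<close> this iterate is the identity, matching the wrap-around of
  \<open>cyc n\<close>.\<close>

lemma circle_pts_tau:
  assumes "z \<in> sphere 0 1" "s \<in> std_simplex n" "i \<in> {1..n}"
  shows "circle_pts n (tau n (z, s)) i = circle_pts n (z, s) (cyc n i)"
proof -
  obtain z' s' where p': "tau n (z, s) = (z', s')"
    by fastforce
  then have s': "s' \<in> std_simplex n"
    using tau_closed_simplex[OF assms(1,2)] by simp
  have "circle_pts n (tau n (z, s)) i = fst ((tau n ^^ (i - 1)) (tau n (z, s)))"
    unfolding p' by (intro circle_pts_conv_tau std_simplex_extensional s' assms)
  also have "\<dots> = fst ((tau n ^^ i) (z, s))"
    using assms(3) funpow_Suc_right[of "i - 1" "tau n"] by simp
  also have "\<dots> = circle_pts n (z, s) (cyc n i)"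
  proof (cases "i = n")
    case True
    then have "(tau n ^^ i) (z, s) = (z, s)"
      using tau_funpow_n[of "(z, s)" n] assms by auto
    then show ?thesis
      using True assms by (simp add: cyc_apply circle_pts_def)
  next
    case False
    then show ?thesis
      using assms circle_pts_conv_tau[OF std_simplex_extensional[OF assms(2)], of "Suc i" z]
      by (simp add: cyc_apply)
  qed
  finally show ?thesis .
qed

lemma tau_funpow_closed_simplex:
  assumes "p \<in> sphere 0 1 \<times> std_simplex n"
  shows "(tau n ^^ k) p \<in> sphere 0 1 \<times> std_simplex n"
proof (induction k)
  case (Suc k)
  then show ?case
    using tau_closed_simplex[of "fst ((tau n ^^ k) p)" "snd ((tau n ^^ k) p)" n]
    by (simp add: mem_Times_iff)
qed (use assms in simp)

lemma tau_funpow_closed: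
  assumes "p \<in> sphere 0 1 \<times> simplex_bd n d"
  shows "(tau n ^^ k) p \<in> sphere 0 1 \<times> simplex_bd n d"
  by (induction k) (use assms tau_closed in auto)

lemma circle_pts_tau_funpow:
  assumes "p \<in> sphere 0 1 \<times> std_simplex n" "i \<in> {1..n}"
  shows "circle_pts n ((tau n ^^ k) p) i = circle_pts n p ((cyc n ^^ k) i)"
  using assms(2)
proof (induction k arbitrary: i)
  case (Suc k)
  have "circle_pts n ((tau n ^^ Suc k) p) i = circle_pts n ((tau n ^^ k) p) (cyc n i)"
    using circle_pts_tau[of "fst ((tau n ^^ k) p)" "snd ((tau n ^^ k) p)" n i]
      tau_funpow_closed_simplex[OF assms(1), of k] Suc.prems by (simp add: mem_Times_iff)
  also have "\<dots> = circle_pts n p ((cyc n ^^ k) (cyc n i))"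
    using Suc.IH[OF cyc_funpow_mem[OF Suc.prems, of 1]] by simp
  finally show ?case
    by (simp add: funpow_swap1)
qed simp

lemma tau_funpow_mod:
  assumes "p \<in> sphere 0 1 \<times> std_simplex n" "n \<ge> 1"
  shows "(tau n ^^ k) p = (tau n ^^ (k mod n)) p"
  by (rule funpow_mod_eq[symmetric]) (rule tau_funpow_n[OF assms])

section \<open>Fibres\<close>

text \<open>
  A fundamental domain of the cyclic action: as the \<open>s\<^sub>i\<close> sum to \<open>1\<close>, the condition \<open>a < s n\<close> says that
  the last lifted angle \<open>a + s\<^sub>1 + \<dots> + s\<^bsub>n-1\<^esub>\<close> is still below \<open>1\<close>.
\<close>

definition tau_reduced :: "nat \<Rightarrow> real \<Rightarrow> (nat \<Rightarrow> real) \<Rightarrow> bool" where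
  "tau_reduced n a s \<longleftrightarrow> s \<in> std_simplex n \<and> 0 \<le> a \<and> a < s n"

text \<open>A real lift of the argument of the \<open>i\<close>-th point, in full turns rather than
  radians, so that one turn is the interval [0, 1).\<close>

definition angle :: "real \<Rightarrow> (nat \<Rightarrow> real) \<Rightarrow> nat \<Rightarrow> real" where
  "angle a s i = a + (\<Sum>j=1..<i. s j)"

lemma circle_pts_angle:
  assumes "i \<in> {1..n}"
  shows "circle_pts n (cis (2 * pi * a), s) i = cis (2 * pi * angle a s i)"
  using assms by (simp add: circle_pts_def angle_def cis_mult distrib_left)

text \<open>The partial sums \<open>U k\<close> grow from \<open>a < 1\<close> to
  \<open>a + 1\<close>. Rotate by the first \<open>k\<close> at which they reach 1. The new base
  angle is \<open>U k - 1\<close>, the new last gap is \<open>s k\<close>, and minimality,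
  \<open>U (k - 1) < 1\<close>, says exactly that the angle is below this gap.\<close>

lemma ex_reduced:
  assumes "p \<in> sphere 0 1 \<times> std_simplex n" "n \<ge> 1"
  shows "\<exists>k a s. (tau n ^^ k) p = (cis (2 * pi * a), s) \<and> tau_reduced n a s"
proof -
  obtain z s where p: "p = (z, s)" and z: "norm z = 1" and s: "s \<in> std_simplex n"
    using assms by auto
  obtain t where t: "0 \<le> t" "t < 2 * pi" "z = cis t"
    using complex_unimodular_polar[OF z] by (metis cis.code)
  define a where "a = t / (2 * pi)"
  have a: "0 \<le> a" "a < 1" "z = cis (2 * pi * a)"
    using t by (auto simp: a_def)
  define U where "U k = a + (\<Sum>j=1..k. s j)" for k
  have Un: "U n \<ge> 1"
    using std_simplex_sum[OF s] a by (simp add: U_def)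
  define k where "k = (LEAST k. U k \<ge> 1)"
  have Uk: "U k \<ge> 1" and kn: "k \<le> n"
    unfolding k_def by (rule LeastI[of _ n], rule Un) (rule Least_le, rule Un)
  have "k \<noteq> 0"
    using Uk a by (auto simp: U_def intro: ccontr)
  then have U1: "U (k - 1) < 1"
    using not_less_Least[of "k - 1" "\<lambda>k. U k \<ge> 1"] by (simp add: k_def[symmetric])
  have UU: "U k = U (k - 1) + s k"
    using \<open>k \<noteq> 0\<close> by (cases k) (auto simp: U_def)
  define s' where "s' = (\<lambda>i\<in>{1..n}. s ((cyc n ^^ k) i))"
  have "(cyc n ^^ k) n = (cyc n ^^ (k - 1)) 1"
    using \<open>k \<noteq> 0\<close> \<open>n \<ge> 1\<close> funpow_Suc_right[of "k - 1" "cyc n"] by (simp add: cyc_apply)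
  also have "\<dots> = k"
    using \<open>k \<noteq> 0\<close> kn cyc_funpow_1[of "k - 1" n] by simp
  finally have s'n: "s' n = s k"
    using \<open>n \<ge> 1\<close> by (simp add: s'_def)
  \<comment> \<open>Subtracting a whole turn from the angle \<open>U k\<close> does not change the
    base point.\<close>
  have eq: "(tau n ^^ k) p = (cis (2 * pi * (U k - 1)), s')"
    unfolding p tau_funpow_cis[OF std_simplex_extensional[OF s] assms(2) kn] s'_def
    by (simp add: a(3) U_def cis_mult right_diff_distrib distrib_left flip: cis_divide)
  moreover have "s' \<in> std_simplex n"
    using tau_funpow_closed_simplex[OF assms(1), of k] by (simp add: eq)
  ultimately show ?thesis
    using Uk U1 UU s'n by (intro exI[of _ k] exI[of _ "U k - 1"] exI[of _ s']) (auto simp: tau_reduced_def)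
qed

section \<open>Uniqueness of the reduced representative\<close>

lemma angle_mono:
  assumes "s \<in> std_simplex n" "i \<le> j" "j \<le> Suc n"
  shows "angle a s i \<le> angle a s j"
  unfolding angle_def using assms
  by (intro add_left_mono sum_mono2) (auto intro!: std_simplex_nonneg)

text \<open>By monotonicity only the extreme angles matter: the first is \<open>a\<close>, the last
  is \<open>a + 1 - s n\<close>.\<close>

lemma angle_reduced_bounds:
  assumes "tau_reduced n a s" "i \<in> {1..n}"
  shows "0 \<le> angle a s i" "angle a s i < 1"
proof -
  have s: "s \<in> std_simplex n"
    using assms by (simp add: tau_reduced_def)
  show "0 \<le> angle a s i"
    using assms angle_mono[OF s, of 1 i a] by (simp add: angle_def tau_reduced_def)
  have "angle a s n + s n = a + 1"
  proof -
    have "(\<Sum>j=1..<n. s j) + s n = (\<Sum>j=1..<Suc n. s j)"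
      using assms(2) by simp
    then show ?thesis
      using std_simplex_sum[OF s] by (simp add: angle_def atLeastLessThanSuc_atLeastAtMost)
  qed
  then show "angle a s i < 1"
    using angle_mono[OF s, of i n a] assms by (auto simp: tau_reduced_def)
qed

lemma cis_2pi_inj:
  assumes "cis (2 * pi * t) = cis (2 * pi * u)" "0 \<le> t" "t < 1" "0 \<le> u" "u < (1::real)"
  shows "t = u"
proof -
  obtain k :: int where "2 * pi * t = 2 * pi * u + 2 * pi * k"
    using assms(1) sin_cos_eq_iff[of "2 * pi * t" "2 * pi * u"] by (auto simp: complex_eq_iff)
  then have "2 * pi * t = 2 * pi * (u + k)"
    by (simp add: algebra_simps)
  then have "t = u + k"
    by simp
  moreover from this have "k = 0"
    using assms by linarith
  ultimately show ?thesis by simp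
qed

text \<open>A permutation of the indices preserves the multiset of values, and a sorted list is
  determined by its multiset.\<close>

lemma sorted_permuted_eq:
  fixes t u :: "nat \<Rightarrow> 'a::linorder"
  assumes \<sigma>: "\<sigma> permutes {1..n}" and eq: "\<And>i. i \<in> {1..n} \<Longrightarrow> t (\<sigma> i) = u i"
    and t: "\<And>i j. 1 \<le> i \<Longrightarrow> i \<le> j \<Longrightarrow> j \<le> n \<Longrightarrow> t i \<le> t j"
    and u: "\<And>i j. 1 \<le> i \<Longrightarrow> i \<le> j \<Longrightarrow> j \<le> n \<Longrightarrow> u i \<le> u j"
    and i: "i \<in> {1..n}"
  shows "t i = u i"
proof -
  have sorted: "sorted (map f [1..<Suc n])"
    if "\<And>i j. 1 \<le> i \<Longrightarrow> i \<le> j \<Longrightarrow> j \<le> n \<Longrightarrow> f i \<le> f j" for f :: "nat \<Rightarrow> 'a"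
    using that by (auto simp: sorted_iff_nth_mono simp del: upt_Suc)
  have "mset (map u [1..<Suc n]) = image_mset u (mset_set {1..n})"
    by (simp add: atLeastLessThanSuc_atLeastAtMost mset_upt del: upt_Suc)
  also have "\<dots> = image_mset (\<lambda>i. t (\<sigma> i)) (mset_set {1..n})"
    using eq by (intro image_mset_cong) auto
  also have "\<dots> = image_mset t (image_mset \<sigma> (mset_set {1..n}))"
    by (simp add: multiset.map_comp comp_def)
  also have "image_mset \<sigma> (mset_set {1..n}) = mset_set {1..n}"
    using image_mset_mset_set[OF permutes_inj_on[OF \<sigma>]] permutes_image[OF \<sigma>] by simp
  also have "image_mset t (mset_set {1..n}) = mset (map t [1..<Suc n])"
    by (simp add: atLeastLessThanSuc_atLeastAtMost mset_upt del: upt_Suc)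
  finally have "map t [1..<Suc n] = map u [1..<Suc n]"
    using sorted[of t] sorted[of u] t u by (metis properties_for_sort)
  then show ?thesis
    using i by (auto simp del: upt_Suc)
qed

text \<open>Reduced angles lie in [0, 1), so equal points have equal angles. Both angle sequences
  are nondecreasing, hence agree without the permutation. Their differences recover all gaps but the
  last, and the total sum recovers that one.\<close>

lemma reduced_unique:
  assumes "tau_reduced n a s" "tau_reduced n b t" "n \<ge> 1" "\<sigma> permutes {1..n}"
    and eq: "\<And>i. i \<in> {1..n} \<Longrightarrow>
      circle_pts n (cis (2 * pi * a), s) (\<sigma> i) = circle_pts n (cis (2 * pi * b), t) i"
  shows "a = b \<and> s = t"
proof -
  have s: "s \<in> std_simplex n" and t: "t \<in> std_simplex n"
    using assms by (auto simp: tau_reduced_def)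
  have "angle a s (\<sigma> i) = angle b t i" if i: "i \<in> {1..n}" for i
  proof -
    have "\<sigma> i \<in> {1..n}"
      using permutes_in_image[OF assms(4)] i by blast
    then show ?thesis
      using eq[OF i] i angle_reduced_bounds[OF assms(1)] angle_reduced_bounds[OF assms(2)]
      by (intro cis_2pi_inj) (simp_all only: circle_pts_angle)
  qed
  then have l: "angle a s i = angle b t i" if "i \<in> {1..n}" for i
    by (rule sorted_permuted_eq[OF assms(4)])
       (use that angle_mono[OF s] angle_mono[OF t] in auto)
  from l[of 1] have "a = b"
    using \<open>n \<ge> 1\<close> by (simp add: angle_def)
  have 1: "s i = t i" if "i \<in> {1..<n}" for i
    using that l[of i] l[of "Suc i"] by (simp add: angle_def)
  have "{1..n} = insert n {1..<n}"
    using \<open>n \<ge> 1\<close> by auto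
  then have "s n = t n"
    using std_simplex_sum[OF s] std_simplex_sum[OF t] sum.cong[OF refl 1, of "{1..<n}"] by simp
  with 1 have "s i = t i" if "i \<in> {1..n}" for i
    using that by (cases "i = n") auto
  then have "s = t"
    using std_simplex_extensional[OF s] std_simplex_extensional[OF t] extensionalityI by blast
  with \<open>a = b\<close> show ?thesis by simp
qed

text \<open>Rotating both pairs into the fundamental domain preserves equality up to a permutation,
  so uniqueness there identifies the rotated pairs. It remains to undo the rotation of
  \<open>q\<close>.\<close>

lemma circle_pts_eq_imp_tau:
  assumes p: "p \<in> sphere 0 1 \<times> std_simplex n" and q: "q \<in> sphere 0 1 \<times> std_simplex n" and "n \<ge> 1"
    and \<sigma>: "\<sigma> permutes {1..n}"
    and eq: "\<And>i. i \<in> {1..n} \<Longrightarrow> circle_pts n p (\<sigma> i) = circle_pts n q i"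
  shows "\<exists>k. q = (tau n ^^ k) p"
proof -
  obtain k a s where k: "(tau n ^^ k) p = (cis (2 * pi * a), s)" "tau_reduced n a s"
    using ex_reduced[OF p \<open>n \<ge> 1\<close>] by blast
  obtain l b t where l: "(tau n ^^ l) q = (cis (2 * pi * b), t)" "tau_reduced n b t"
    using ex_reduced[OF q \<open>n \<ge> 1\<close>] by blast
  \<comment> \<open>This is \<sigma> rewritten in the rotated numberings of both lists.\<close>
  define \<rho> where "\<rho> = inv' (cyc n ^^ k) \<circ> \<sigma> \<circ> (cyc n ^^ l)"
  have ck: "(cyc n ^^ k) permutes {1..n}" and cl: "(cyc n ^^ l) permutes {1..n}"
    by (rule permutes_funpow[OF cyc_permutes])+
  have \<rho>: "\<rho> permutes {1..n}"
    unfolding \<rho>_def by (intro permutes_compose permutes_inv ck cl \<sigma>)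
  have "circle_pts n (cis (2 * pi * a), s) (\<rho> i) = circle_pts n (cis (2 * pi * b), t) i"
    if i: "i \<in> {1..n}" for i
  proof -
    have "\<rho> i \<in> {1..n}"
      using permutes_in_image[OF \<rho>] i by blast
    then have "circle_pts n (cis (2 * pi * a), s) (\<rho> i) = circle_pts n p ((cyc n ^^ k) (\<rho> i))"
      using circle_pts_tau_funpow[OF p, of "\<rho> i" k] by (simp add: k)
    also have "(cyc n ^^ k) (\<rho> i) = \<sigma> ((cyc n ^^ l) i)"
      using permutes_inverses(1)[OF ck] by (simp add: \<rho>_def)
    also have "circle_pts n p \<dots> = circle_pts n q ((cyc n ^^ l) i)"
      by (rule eq[OF cyc_funpow_mem[OF i]])
    also have "\<dots> = circle_pts n (cis (2 * pi * b), t) i"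
      using circle_pts_tau_funpow[OF q i, of l] by (simp add: l)
    finally show ?thesis .
  qed
  from reduced_unique[OF k(2) l(2) \<open>n \<ge> 1\<close> \<rho> this] have kl: "(tau n ^^ k) p = (tau n ^^ l) q"
    by (simp add: k l)
  \<comment> \<open>\<open>n * l - l\<close> is a natural number congruent to \<open>-l\<close>
    modulo \<open>n\<close>, so this many further rotations invert the \<open>l\<close>-th
    iterate.\<close>
  have "n * l = (n * l - l) + l"
    using \<open>n \<ge> 1\<close> by simp
  then have "(tau n ^^ (n * l - l)) ((tau n ^^ l) q) = (tau n ^^ (n * l)) q"
    by (metis comp_apply funpow_add)
  also have "\<dots> = q"
    using tau_funpow_mod[OF q \<open>n \<ge> 1\<close>, of "n * l"] by simp
  finally have "q = (tau n ^^ (n * l - l + k)) p"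
    by (simp add: kl[symmetric] funpow_add)
  then show ?thesis ..
qed

section \<open>Surjectivity\<close>

lemma ex_sorting_permutation:
  fixes t :: "nat \<Rightarrow> 'a::linorder"
  shows "\<exists>\<sigma>. \<sigma> permutes {1..n} \<and> (\<forall>i j. 1 \<le> i \<longrightarrow> i \<le> j \<longrightarrow> j \<le> n \<longrightarrow> t (\<sigma> i) \<le> t (\<sigma> j))"
proof -
  define xs where "xs = sort_key t [1..<Suc n]"
  have xs: "length xs = n" "distinct xs" "set xs = {1..n}"
    by (auto simp: xs_def simp del: upt_Suc)
  \<comment> \<open>List positions start at 0, tuple indices at 1. Outside the index set a
    permutation must be the identity.\<close>
  define \<sigma> where "\<sigma> i = (if i \<in> {1..n} then xs ! (i - 1) else i)" for i
  have "bij_betw (\<lambda>i. xs ! (i - 1)) {1..n} {1..n}"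
  proof (rule bij_betw_trans[unfolded comp_def, of "\<lambda>i. i - 1" _ "{..<n}"])
    show "bij_betw (\<lambda>i. i - 1) {1..n} {..<n}"
      by (rule bij_betwI[of _ _ _ Suc]) auto
    show "bij_betw ((!) xs) {..<n} {1..n}"
      using xs by (intro bij_betw_nth) auto
  qed
  then have "bij_betw \<sigma> {1..n} {1..n}"
    by (rule bij_betw_cong[THEN iffD1, rotated]) (simp add: \<sigma>_def)
  then have "\<sigma> permutes {1..n}"
    by (rule bij_imp_permutes) (auto simp: \<sigma>_def)
  moreover have "t (\<sigma> i) \<le> t (\<sigma> j)" if "1 \<le> i" "i \<le> j" "j \<le> n" for i j
  proof -
    have "sorted (map t xs)"
      by (simp add: xs_def)
    then have "map t xs ! (i - 1) \<le> map t xs ! (j - 1)"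
      using that xs by (intro sorted_nth_mono) auto
    then show ?thesis
      using that xs by (simp add: \<sigma>_def)
  qed
  ultimately show ?thesis
    by blast
qed

text \<open>Choose arguments in [0, 1) and sort them. The gaps are the successive differences, and
  the final gap returns to the smallest argument one turn later.\<close>

lemma ex_circle_pts:
  assumes x: "\<And>i. i \<in> {1..n} \<Longrightarrow> x i \<in> sphere 0 1" and "n \<ge> 1"
  shows "\<exists>p\<in>sphere 0 1 \<times> std_simplex n. \<exists>\<sigma>. \<sigma> permutes {1..n} \<and>
    (\<forall>i\<in>{1..n}. x (\<sigma> i) = circle_pts n p i)"
proof -
  have "\<exists>t. 0 \<le> t \<and> t < 1 \<and> x i = cis (2 * pi * t)" if i: "i \<in> {1..n}" for i
  proof -
    have "norm (x i) = 1"
      using x[OF i] by simp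
    then obtain t where "0 \<le> t" "t < 2 * pi" "x i = cis t"
      using complex_unimodular_polar by (metis cis.code)
    then show ?thesis
      by (intro exI[of _ "t / (2 * pi)"]) auto
  qed
  then obtain t where t: "\<And>i. i \<in> {1..n} \<Longrightarrow> 0 \<le> t i \<and> t i < (1::real) \<and> x i = cis (2 * pi * t i)"
    by metis
  obtain \<sigma> where \<sigma>: "\<sigma> permutes {1..n}"
    and mono: "\<And>i j. 1 \<le> i \<Longrightarrow> i \<le> j \<Longrightarrow> j \<le> n \<Longrightarrow> t (\<sigma> i) \<le> t (\<sigma> j)"
    using ex_sorting_permutation[of n t] by blast
  have mem: "\<sigma> i \<in> {1..n}" if "i \<in> {1..n}" for i
    using permutes_in_image[OF \<sigma>] that by blast
  define a where "a = t (\<sigma> 1)"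
  define s where "s = (\<lambda>i\<in>{1..n}. if i = n then 1 + a - t (\<sigma> n) else t (\<sigma> (Suc i)) - t (\<sigma> i))"
  \<comment> \<open>The sum of the gaps telescopes to the sorted arguments.\<close>
  have angle: "angle a s i = t (\<sigma> i)" if "i \<in> {1..n}" for i
  proof -
    have "1 \<le> i" "i \<le> n"
      using that by auto
    then show ?thesis
      by (induction i rule: dec_induct) (auto simp: angle_def a_def s_def)
  qed
  have "s \<in> std_simplex n"
  proof (rule std_simplexI)
    fix i assume i: "i \<in> {1..n}"
    show "s i \<ge> 0"
    proof (cases "i = n")
      case True
      then show ?thesis
        using t[OF mem[of 1]] t[OF mem[of n]] \<open>n \<ge> 1\<close> by (simp add: s_def a_def)
    qed (use i mono[of i "Suc i"] in \<open>auto simp: s_def\<close>)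
  next
    have "{1..n} = insert n {1..<n}"
      using \<open>n \<ge> 1\<close> by auto
    then have "(\<Sum>i=1..n. s i) = s n + (\<Sum>j=1..<n. s j)"
      by simp
    also have "\<dots> = s n + angle a s n - a"
      by (simp add: angle_def)
    finally show "(\<Sum>i=1..n. s i) = 1"
      using angle[of n] \<open>n \<ge> 1\<close> by (simp add: s_def)
  qed (simp add: s_def)
  moreover have "\<forall>i\<in>{1..n}. x (\<sigma> i) = circle_pts n (cis (2 * pi * a), s) i"
  proof
    fix i assume i: "i \<in> {1..n}"
    show "x (\<sigma> i) = circle_pts n (cis (2 * pi * a), s) i"
      unfolding circle_pts_angle[OF i] angle[OF i] using t[OF mem[OF i]] by blast
  qed
  ultimately show ?thesis
    using \<sigma> by (intro bexI[of _ "(cis (2 * pi * a), s)"]) auto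
qed

section \<open>Multiplicities\<close>

text \<open>The condition that cuts out \<open>mult_space\<close>, isolated so that it can be
  handled apart from the topology.\<close>

definition mult_le :: "nat \<Rightarrow> nat \<Rightarrow> (nat \<Rightarrow> 'a) \<Rightarrow> bool" where
  "mult_le d n x \<longleftrightarrow> \<not> (\<exists>I \<subseteq> {1..n}. card I = d + 1 \<and> (\<forall>i\<in>I. \<forall>j\<in>I. x i = x j))"

text \<open>A set of indices with equal entries is carried by \<sigma> to one of the same
  size.\<close>

lemma mult_le_permute:
  assumes \<sigma>: "\<sigma> permutes {1..n}" and eq: "\<And>i. i \<in> {1..n} \<Longrightarrow> x (\<sigma> i) = y i" and x: "mult_le d n x"
  shows "mult_le d n y"
  unfolding mult_le_def
proof (safe)
  fix I assume I: "I \<subseteq> {1..n}" "card I = d + 1" "\<forall>i\<in>I. \<forall>j\<in>I. y i = y j"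
  have "\<sigma> ` I \<subseteq> {1..n}"
    using I(1) permutes_in_image[OF \<sigma>] by blast
  moreover have "card (\<sigma> ` I) = d + 1"
    using I(2) card_image[OF permutes_inj_on[OF \<sigma>]] by simp
  moreover have "\<forall>i\<in>\<sigma> ` I. \<forall>j\<in>\<sigma> ` I. x i = x j"
  proof (intro ballI, elim imageE)
    fix u v i j assume "u = \<sigma> i" "v = \<sigma> j" and ij: "i \<in> I" "j \<in> I"
    moreover have "i \<in> {1..n}" "j \<in> {1..n}"
      using ij I(1) by blast+
    moreover have "y i = y j"
      using ij I(3) by blast
    ultimately show "x u = x v"
      using eq by simp
  qed
  ultimately show False
    using x unfolding mult_le_def by blast
qed

text \<open>If \<open>d\<close> consecutive gaps vanish, the \<open>d + 1\<close> points they
  separate coincide. These have distinct indices once \<open>d < n\<close>, and this holds because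
  the gaps sum to 1 and cannot all vanish.\<close>

lemma mult_le_circle_ptsD:
  assumes z: "z \<in> sphere 0 1" and s: "s \<in> std_simplex n" and "mult_le d n (circle_pts n (z, s))"
    and "d \<ge> 1"
  shows "s \<in> simplex_bd n d"
proof -
  have "m \<le> d - 1" if i: "i \<in> {1..n}" and m: "m \<le> n" and zero: "\<forall>j<m. s ((cyc n ^^ j) i) = 0" for i m
  proof (rule ccontr)
    assume "\<not> m \<le> d - 1"
    then have d: "d \<le> m"
      by simp
    have "m \<noteq> n"
    proof
      assume "m = n"
      then have "s j = 0" if "j \<in> {1..n}" for j
        using cyc_orbit[OF i that] zero by auto
      then show False
        using std_simplex_sum[OF s] by simp
    qed
    with m d have dn: "d < n"
      by simp
    let ?I = "(\<lambda>k. (cyc n ^^ k) i) ` {..d}"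
    have pts: "circle_pts n (z, s) ((cyc n ^^ k) i) = circle_pts n (z, s) i" if "k \<le> d" for k
      using that
    proof (induction k)
      case (Suc k)
      then show ?case
        using circle_pts_cyc[OF z s cyc_funpow_mem[OF i, of k]] zero d by simp
    qed simp
    have "inj_on (\<lambda>k. (cyc n ^^ k) i) {..d}"
      by (rule inj_on_subset[OF inj_on_cyc_orbit[OF i]]) (use dn in auto)
    then have "card ?I = d + 1"
      by (simp add: card_image)
    moreover have "?I \<subseteq> {1..n}"
      using cyc_funpow_mem[OF i] by blast
    moreover have "\<forall>u\<in>?I. \<forall>v\<in>?I. circle_pts n (z, s) u = circle_pts n (z, s) v"
      using pts by auto
    ultimately show False
      using assms(3) unfolding mult_le_def by blast
  qed
  then show ?thesis
    using s unfolding simplex_bd_def by blast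
qed

text \<open>For a reduced pair, equal points have equal angles, so a cluster never continues past
  index \<open>n\<close>. All gaps between its smallest and largest index vanish, and
  \<open>d + 1\<close> indices span at least \<open>d\<close> gaps.\<close>

lemma mult_le_circle_pts_reduced:
  assumes "tau_reduced n a s" "s \<in> simplex_bd n d" "d \<ge> 1"
  shows "mult_le d n (circle_pts n (cis (2 * pi * a), s))"
  unfolding mult_le_def
proof (safe)
  have s: "s \<in> std_simplex n"
    using assms by (simp add: tau_reduced_def)
  fix I assume I: "I \<subseteq> {1..n}" "card I = d + 1"
    and eq: "\<forall>i\<in>I. \<forall>j\<in>I. circle_pts n (cis (2 * pi * a), s) i = circle_pts n (cis (2 * pi * a), s) j"
  have fin: "finite I" "I \<noteq> {}"
    using I by (auto intro: finite_subset)
  define i j where "i = Min I" and "j = Max I"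
  have ij: "i \<in> I" "j \<in> I"
    using fin by (auto simp: i_def j_def)
  then have ij': "i \<in> {1..n}" "j \<in> {1..n}"
    using I by auto
  have "I \<subseteq> {i..j}"
    using fin by (auto simp: i_def j_def)
  then have "card I \<le> card {i..j}"
    by (intro card_mono) auto
  then have j: "i + d \<le> j"
    using I by simp
  have "angle a s i = angle a s j"
    using bspec[OF bspec[OF eq ij(1)] ij(2)] ij' angle_reduced_bounds[OF assms(1)]
    by (intro cis_2pi_inj) (simp_all only: circle_pts_angle)
  moreover have "angle a s j = angle a s i + (\<Sum>k=i..<j. s k)"
    using ij' j sum.atLeastLessThan_concat[of 1 i j s] by (simp add: angle_def)
  ultimately have "(\<Sum>k=i..<j. s k) = 0"
    by simp
  then have z: "s k = 0" if "k \<in> {i..<j}" for k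
    using that ij' by (subst (asm) sum_nonneg_eq_0_iff) (auto intro!: std_simplex_nonneg[OF s])
  have "\<forall>k<d. s ((cyc n ^^ k) i) = 0"
  proof (intro allI impI)
    fix k assume "k < d"
    then show "s ((cyc n ^^ k) i) = 0"
      using z[of "i + k"] cyc_funpow_add[of i k n] ij' j by simp
  qed
  moreover have "d \<le> n"
    using j ij' by simp
  ultimately have "d \<le> d - 1"
    using assms(2) ij'(1) unfolding simplex_bd_def by blast
  then show False
    using \<open>d \<ge> 1\<close> by simp
qed

text \<open>Rotation preserves both the bound on runs of zeros and the multiplicities, which reduces
  the claim to the fundamental domain.\<close>

lemma mult_le_circle_pts:
  assumes "p \<in> sphere 0 1 \<times> simplex_bd n d" "n \<ge> 1" "d \<ge> 1"
  shows "mult_le d n (circle_pts n p)"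
proof -
  have p: "p \<in> sphere 0 1 \<times> std_simplex n"
    using assms(1) simplex_bd_subset by blast
  obtain k a s where k: "(tau n ^^ k) p = (cis (2 * pi * a), s)" "tau_reduced n a s"
    using ex_reduced[OF p \<open>n \<ge> 1\<close>] by blast
  have ck: "(cyc n ^^ k) permutes {1..n}"
    by (rule permutes_funpow[OF cyc_permutes])
  have "s \<in> simplex_bd n d"
    using tau_funpow_closed[OF assms(1), of k] by (simp add: k)
  from mult_le_circle_pts_reduced[OF k(2) this \<open>d \<ge> 1\<close>]
  have "mult_le d n (circle_pts n ((tau n ^^ k) p))"
    by (simp add: k)
  then show ?thesis
  proof (rule mult_le_permute[OF permutes_inv[OF ck], rotated])
    fix i assume "i \<in> {1..n}"
    then have "inv' (cyc n ^^ k) i \<in> {1..n}"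
      using permutes_in_image[OF permutes_inv[OF ck]] by blast
    then show "circle_pts n ((tau n ^^ k) p) (inv' (cyc n ^^ k) i) = circle_pts n p i"
      by (simp only: circle_pts_tau_funpow[OF p] permutes_inverses(1)[OF ck])
  qed
qed

section \<open>Quotient maps, orbits and permutations\<close>

text \<open>Each map is constant on the fibres of the other and so descends to its quotient; the two
  descended maps are mutually inverse. The formula for \<open>h\<close> on classes is kept for
  proving equivariance.\<close>

lemma homeomorphic_map_quotient_maps:
  assumes q: "quotient_map X Y q" and r: "quotient_map X Z r"
    and eq: "\<And>x y. x \<in> topspace X \<Longrightarrow> y \<in> topspace X \<Longrightarrow> q x = q y \<longleftrightarrow> r x = r y"
  obtains h where "homeomorphic_map Y Z h" "\<And>x. x \<in> topspace X \<Longrightarrow> h (q x) = r x"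
proof -
  obtain h where h: "continuous_map Y Z h" "\<And>x. x \<in> topspace X \<Longrightarrow> h (q x) = r x"
    using quotient_map_lift_exists[OF q quotient_imp_continuous_map[OF r]] eq by metis
  obtain k where k: "continuous_map Z Y k" "\<And>x. x \<in> topspace X \<Longrightarrow> k (r x) = q x"
    using quotient_map_lift_exists[OF r quotient_imp_continuous_map[OF q]] eq by metis
  have "homeomorphic_maps Y Z h k"
    unfolding homeomorphic_maps_def quotient_imp_surjective_map[OF q, symmetric]
      quotient_imp_surjective_map[OF r, symmetric]
    using h k by auto
  then show ?thesis
    using that h(2) homeomorphic_map_maps by blast
qed

text \<open>A product with a discrete factor is a disjoint union of open slices, so openness of a
  preimage is checked slice by slice.\<close>

lemma continuous_map_prod_discrete:
  assumes "\<And>d. d \<in> D \<Longrightarrow> continuous_map X Y (\<lambda>x. f (x, d))"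
  shows "continuous_map (prod_topology X (discrete_topology D)) Y f"
  unfolding continuous_map_def
proof (intro conjI allI impI)
  show "f \<in> topspace (prod_topology X (discrete_topology D)) \<rightarrow> topspace Y"
    using assms by (auto simp: continuous_map_def Pi_iff)
  fix U assume U: "openin Y U"
  have "{p \<in> topspace (prod_topology X (discrete_topology D)). f p \<in> U} =
      (\<Union>d\<in>D. {x \<in> topspace X. f (x, d) \<in> U} \<times> {d})"
    by auto
  moreover have "openin (prod_topology X (discrete_topology D))
      ({x \<in> topspace X. f (x, d) \<in> U} \<times> {d})" if "d \<in> D" for d
    using assms[OF that] U that by (simp add: openin_prod_Times_iff continuous_map_def)
  ultimately show "openin (prod_topology X (discrete_topology D))
      {p \<in> topspace (prod_topology X (discrete_topology D)). f p \<in> U}"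
    by auto
qed

text \<open>\<open>group_action\<close> concerns the restricted maps, whereas
  \<open>orbit_space\<close> uses the plain ones. On \<open>E\<close> both give the same orbits, so
  the equivalence relation carries over.\<close>

lemma orbit_eq_iff:
  assumes act: "group_action G E (\<lambda>g. restrict (\<phi> g) E)" and x: "x \<in> E" and y: "y \<in> E"
  shows "orbit G \<phi> x = orbit G \<phi> y \<longleftrightarrow> (\<exists>g\<in>carrier G. y = \<phi> g x)"
proof -
  interpret group_action G E "\<lambda>g. restrict (\<phi> g) E" by fact
  have orb: "orbit G (\<lambda>g. restrict (\<phi> g) E) u = orbit G \<phi> u" if "u \<in> E" for u
    using that by (simp add: orbit_def)
  have sub: "v \<in> E" if "u \<in> E" "v \<in> orbit G \<phi> u" for u v
    using that element_image[of _ u] by (auto simp: orbit_def)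
  have "orbit G \<phi> x = orbit G \<phi> y \<longleftrightarrow> y \<in> orbit G \<phi> x"
  proof
    assume "orbit G \<phi> x = orbit G \<phi> y"
    then show "y \<in> orbit G \<phi> x"
      using orbit_refl[OF y] by (simp add: orb y)
  next
    assume yx: "y \<in> orbit G \<phi> x"
    then have xy: "x \<in> orbit G \<phi> y"
      using orbit_sym[OF x y] by (simp add: orb x y)
    have tr: "orbit G \<phi> v \<subseteq> orbit G \<phi> u" if "u \<in> E" "v \<in> E" "v \<in> orbit G \<phi> u" for u v
      using orbit_trans[of u v] that sub by (auto simp: orb)
    show "orbit G \<phi> x = orbit G \<phi> y"
      using tr[OF x y yx] tr[OF y x xy] by blast
  qed
  then show ?thesis
    by (auto simp: orbit_def)
qed

text \<open>Exponents can be reduced modulo the period, so arbitrary natural iterates may replace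
  the representatives below \<open>n\<close>.\<close>

lemma cyclic_act_orbit_iff:
  assumes "n \<ge> 1" and period: "(t ^^ n) x = x"
  shows "(\<exists>k\<in>carrier (integer_mod_group n). y = cyclic_act t k x) \<longleftrightarrow> (\<exists>k. y = (t ^^ k) x)"
proof
  assume "\<exists>k. y = (t ^^ k) x"
  then obtain k where "y = (t ^^ k) x" ..
  then have "y = (t ^^ (k mod n)) x"
    using funpow_mod_eq[OF period] by simp
  then have "y = cyclic_act t (int (k mod n)) x"
    by (simp add: cyclic_act_def)
  moreover have "int (k mod n) \<in> carrier (integer_mod_group n)"
    using \<open>n \<ge> 1\<close> by (simp add: carrier_integer_mod_group)
  ultimately show "\<exists>k\<in>carrier (integer_mod_group n). y = cyclic_act t k x"
    by blast
qed (auto simp: cyclic_act_def)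

section \<open>The permutation action on tuples\<close>

lemma perm_act_inv:
  assumes "\<sigma> permutes {1..n}"
  shows "perm_act n \<sigma> x = (\<lambda>i\<in>{1..n}. x (inv' \<sigma> i))"
  using assms by (simp add: perm_act_def sym_group_carrier)

text \<open>Trades the inverse inside \<open>perm_act\<close> for evaluation at
  \<open>\<sigma> i\<close>.\<close>

lemma perm_act_eq_iff:
  assumes \<sigma>: "\<sigma> permutes {1..n}" and y: "y \<in> extensional {1..n}"
  shows "perm_act n \<sigma> x = y \<longleftrightarrow> (\<forall>i\<in>{1..n}. y (\<sigma> i) = x i)"
proof
  assume "perm_act n \<sigma> x = y"
  then show "\<forall>i\<in>{1..n}. y (\<sigma> i) = x i"
    using perm_act_apply[OF \<sigma>] by metis
next
  assume eq: "\<forall>i\<in>{1..n}. y (\<sigma> i) = x i"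
  show "perm_act n \<sigma> x = y"
  proof (rule extensionalityI[of _ "{1..n}"])
    fix i assume i: "i \<in> {1..n}"
    then have "inv' \<sigma> i \<in> {1..n}"
      using permutes_in_image[OF permutes_inv[OF \<sigma>]] by blast
    with eq have "y (\<sigma> (inv' \<sigma> i)) = x (inv' \<sigma> i)" ..
    then show "perm_act n \<sigma> x i = y i"
      using i by (simp add: perm_act_inv[OF \<sigma>] permutes_inverses(1)[OF \<sigma>])
  qed (use y in \<open>auto simp: perm_act_def\<close>)
qed

lemma perm_act_comp:
  assumes "g permutes {1..n}" "\<sigma> permutes {1..n}"
  shows "perm_act n g (perm_act n \<sigma> x) = perm_act n (g \<circ> \<sigma>) x"
proof -
  have "perm_act n g (perm_act n \<sigma> x) ((g \<circ> \<sigma>) i) = x i" if i: "i \<in> {1..n}" for i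
  proof -
    have "\<sigma> i \<in> {1..n}"
      using i permutes_in_image[OF assms(2)] by blast
    then show ?thesis
      by (simp only: comp_apply perm_act_apply[OF assms(1)] perm_act_apply[OF assms(2) i])
  qed
  then have "perm_act n (g \<circ> \<sigma>) x = perm_act n g (perm_act n \<sigma> x)"
    by (subst perm_act_eq_iff[OF permutes_compose[OF assms(2,1)]]) (simp_all add: perm_act_def[of n g])
  then show ?thesis by simp
qed

text \<open>Freeness of the action on tuples with distinct entries: the entry at position
  \<open>\<sigma> i\<close> determines which index was sent there.\<close>

lemma perm_act_cancel:
  assumes "\<sigma> permutes {1..n}" "\<rho> permutes {1..n}" and "perm_act n \<sigma> x = perm_act n \<rho> x"
    and "inj_on x {1..n}"
  shows "\<sigma> = \<rho>"
proof
  fix i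
  show "\<sigma> i = \<rho> i"
  proof (cases "i \<in> {1..n}")
    case True
    define j where "j = inv' \<rho> (\<sigma> i)"
    have \<sigma>i: "\<sigma> i \<in> {1..n}" and j: "j \<in> {1..n}"
      unfolding j_def using True permutes_in_image[OF assms(1)] permutes_in_image[OF permutes_inv[OF assms(2)]]
      by blast+
    have "\<rho> j = \<sigma> i"
      by (simp add: j_def permutes_inverses(1)[OF assms(2)])
    then have "x i = x j"
      using perm_act_apply[OF assms(1) True, of x] perm_act_apply[OF assms(2) j, of x] assms(3) by simp
    then have "i = j"
      using inj_onD[OF assms(4)] True j by blast
    with \<open>\<rho> j = \<sigma> i\<close> show ?thesis by simp
  next
    case False
    then show ?thesis
      using permutes_not_in[OF assms(1)] permutes_not_in[OF assms(2)] by metis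
  qed
qed

section \<open>The labelled quotient map\<close>

lemma mult_space_eq:
  "mult_space d X n = subtopology (product_topology (\<lambda>_. X) {1..n}) {x. mult_le d n x}"
  by (simp add: mult_space_def mult_le_def)

lemma topspace_mult_space:
  "topspace (mult_space d X n) = {x \<in> {1..n} \<rightarrow>\<^sub>E topspace X. mult_le d n x}"
  by (auto simp: mult_space_eq)

lemma mult_le_perm_act_iff:
  assumes "\<sigma> permutes {1..n}"
  shows "mult_le d n (perm_act n \<sigma> x) \<longleftrightarrow> mult_le d n x"
proof
  assume "mult_le d n (perm_act n \<sigma> x)"
  then show "mult_le d n x"
    by (rule mult_le_permute[OF assms, rotated]) (rule perm_act_apply[OF assms])
next
  assume "mult_le d n x"
  then show "mult_le d n (perm_act n \<sigma> x)"
    by (rule mult_le_permute[OF permutes_inv[OF assms], rotated])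
      (simp add: perm_act_inv[OF assms] del: atLeastAtMost_iff)
qed

section \<open>Continuity and compactness\<close>

lemma circle_pts_PiE:
  assumes "p \<in> sphere 0 1 \<times> S"
  shows "circle_pts n p \<in> {1..n} \<rightarrow>\<^sub>E sphere 0 1"
  using assms by (auto simp: circle_pts_def norm_mult)

lemma continuous_map_circle_pts:
  "continuous_map (circle_times n S) (product_topology (\<lambda>_. circle) {1..n}) (circle_pts n)"
proof -
  have "continuous_map (circle_times n S) circle (\<lambda>p. circle_pts n p i)" if i: "i \<in> {1..n}" for i
  proof -
    have fst: "continuous_map (circle_times n S) euclidean fst"
      unfolding circle_times_def
      by (rule continuous_map_into_fulltopology[OF continuous_map_fst])
    have s: "continuous_map (circle_times n S) euclideanreal (\<lambda>p. snd p j)" if "j \<in> {1..<i}" for j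
    proof -
      have "continuous_map (subtopology (product_topology (\<lambda>_. euclideanreal) {1..n}) S) euclideanreal (\<lambda>s. s j)"
        using that i by (intro continuous_map_from_subtopology continuous_map_product_projection) auto
      from continuous_map_compose[OF continuous_map_snd this] show ?thesis
        by (simp add: circle_times_def comp_def)
    qed
    have "continuous_map (circle_times n S) euclideanreal (\<lambda>p. \<Sum>j=1..<i. snd p j)"
      using s by (intro continuous_map_sum) auto
    moreover have "continuous_map euclideanreal (euclidean :: complex topology) (\<lambda>t. cis (2 * pi * t))"
      by (auto intro!: continuous_intros)
    ultimately have "continuous_map (circle_times n S) (euclidean :: complex topology)
        (\<lambda>p. cis (2 * pi * (\<Sum>j=1..<i. snd p j)))"
      by (rule continuous_map_compose[unfolded comp_def])
    with fst have pair: "continuous_map (circle_times n S) (prod_topology euclidean euclidean)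
        (\<lambda>p. (fst p, cis (2 * pi * (\<Sum>j=1..<i. snd p j))))"
      by (rule continuous_map_pairedI)
    have mult: "continuous_map (prod_topology euclidean euclidean) (euclidean :: complex topology)
        (\<lambda>p. fst p * snd p)"
      by (auto intro!: continuous_intros)
    have "continuous_map (circle_times n S) (euclidean :: complex topology)
        (\<lambda>p. fst p * cis (2 * pi * (\<Sum>j=1..<i. snd p j)))"
      using continuous_map_compose[OF pair mult] by (simp add: comp_def)
    then show ?thesis
      using i by (auto simp: continuous_map_in_subtopology circle_pts_def case_prod_beta' norm_mult
          circle_times_def)
  qed
  then show ?thesis
    by (auto simp: continuous_map_componentwise circle_pts_def)
qed

text \<open>The simplex is the intersection of a compact cube with the closed hyperplane on which
  the coordinates sum to 1.\<close>

lemma compact_space_circle_times: "compact_space (circle_times n (std_simplex n))"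
proof -
  let ?P = "product_topology (\<lambda>_::nat. euclideanreal) {1..n}"
  have "compactin ?P ({1..n} \<rightarrow>\<^sub>E {0..1})"
    by (simp add: compactin_PiE)
  moreover have "closedin ?P {s \<in> topspace ?P. (\<Sum>i=1..n. s i) \<in> {1}}"
    by (intro closedin_continuous_map_preimage[of _ euclideanreal] continuous_map_sum
        continuous_map_product_projection) auto
  ultimately have "compactin ?P (({1..n} \<rightarrow>\<^sub>E {0..1}) \<inter> {s \<in> topspace ?P. (\<Sum>i=1..n. s i) \<in> {1}})"
    by (rule compact_Int_closedin)
  also have "({1..n} \<rightarrow>\<^sub>E {0..1}) \<inter> {s \<in> topspace ?P. (\<Sum>i=1..n. s i) \<in> {1}} = std_simplex n"
    by (auto simp: std_simplex_def)
  finally show ?thesis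
    by (simp add: circle_times_def compact_space_prod_topology compact_space_subtopology)
qed

text \<open>The \<open>i\<close>-th point in cyclic order becomes entry \<open>\<sigma> i\<close> of
  the tuple.\<close>

definition labelled_pts ::
    "nat \<Rightarrow> (complex \<times> (nat \<Rightarrow> real)) \<times> (nat \<Rightarrow> nat) \<Rightarrow> nat \<Rightarrow> complex" where
  "labelled_pts n = (\<lambda>(p, \<sigma>). perm_act n \<sigma> (circle_pts n p))"

abbreviation labelled_space ::
    "nat \<Rightarrow> (nat \<Rightarrow> real) set \<Rightarrow> ((complex \<times> (nat \<Rightarrow> real)) \<times> (nat \<Rightarrow> nat)) topology" where
  "labelled_space n S \<equiv> prod_topology (circle_times n S) (discrete_topology (carrier (sym_group n)))"

lemma topspace_labelled_space:
  assumes "S \<subseteq> std_simplex n"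
  shows "topspace (labelled_space n S) = (sphere 0 1 \<times> S) \<times> {\<sigma>. \<sigma> permutes {1..n}}"
  using topspace_circle_times[OF assms] by (simp add: sym_group_def)

lemma continuous_map_labelled_pts:
  "continuous_map (labelled_space n S) (product_topology (\<lambda>_. circle) {1..n}) (labelled_pts n)"
proof (rule continuous_map_prod_discrete)
  fix \<sigma> assume "\<sigma> \<in> carrier (sym_group n)"
  then have \<sigma>: "\<sigma> permutes {1..n}"
    by (simp add: sym_group_carrier)
  have "continuous_map (circle_times n S) circle (\<lambda>p. circle_pts n p (inv' \<sigma> i))"
    if "i \<in> {1..n}" for i
  proof -
    have "inv' \<sigma> i \<in> {1..n}"
      using that permutes_in_image[OF permutes_inv[OF \<sigma>]] by blast
    then show ?thesis
      using continuous_map_circle_pts[of n S] by (auto simp: continuous_map_componentwise)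
  qed
  then show "continuous_map (circle_times n S) (product_topology (\<lambda>_. circle) {1..n})
      (\<lambda>p. labelled_pts n (p, \<sigma>))"
    by (auto simp: continuous_map_componentwise labelled_pts_def perm_act_inv[OF \<sigma>])
qed

text \<open>Shows that the part over \<open>simplex_bd n d\<close> is a full preimage, which is what
  restricting a closed map requires.\<close>

lemma labelled_pts_mult_le_iff:
  assumes q: "q \<in> topspace (labelled_space n (std_simplex n))" and "n \<ge> 1" "d \<ge> 1"
  shows "mult_le d n (labelled_pts n q) \<longleftrightarrow> q \<in> topspace (labelled_space n (simplex_bd n d))"
proof -
  obtain z s \<sigma> where q': "q = ((z, s), \<sigma>)" "z \<in> sphere 0 1" "s \<in> std_simplex n" "\<sigma> permutes {1..n}"
    using q unfolding topspace_labelled_space[OF order_refl] by auto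
  then show ?thesis
    unfolding topspace_labelled_space[OF simplex_bd_subset]
    using mult_le_circle_ptsD[of z s n d] mult_le_circle_pts[of "(z, s)" n d] assms(2,3)
    by (auto simp: labelled_pts_def mult_le_perm_act_iff)
qed

lemma labelled_pts_surj:
  assumes "n \<ge> 1" "x \<in> {1..n} \<rightarrow>\<^sub>E sphere 0 1"
  shows "\<exists>q\<in>topspace (labelled_space n (std_simplex n)). labelled_pts n q = x"
proof -
  have "x i \<in> sphere 0 1" if "i \<in> {1..n}" for i
    using assms(2) that by (rule PiE_mem)
  from ex_circle_pts[of n x, OF this \<open>n \<ge> 1\<close>] obtain p \<sigma> where
    p: "p \<in> sphere 0 1 \<times> std_simplex n" "\<sigma> permutes {1..n}" "\<forall>i\<in>{1..n}. x (\<sigma> i) = circle_pts n p i"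
    by blast
  have "x \<in> extensional {1..n}"
    using assms(2) by (simp add: PiE_def)
  then have "labelled_pts n (p, \<sigma>) = x"
    using p by (simp only: labelled_pts_def case_prod_conv perm_act_eq_iff)
  then show ?thesis
    using p unfolding topspace_labelled_space[OF order_refl] by blast
qed

text \<open>Since \<open>simplex_bd n d\<close> need not be compact, closedness is first obtained
  over the whole simplex, from a compact source and a Hausdorff target. It then passes to the full
  preimage of the subspace of bounded multiplicity.\<close>

lemma quotient_map_labelled_pts:
  assumes "n \<ge> 1" "d \<ge> 1"
  shows "quotient_map (labelled_space n (simplex_bd n d)) (mult_space d circle n) (labelled_pts n)"
proof -
  let ?T = "labelled_space n (std_simplex n)" and ?P = "product_topology (\<lambda>_. circle) {1..n}"
  let ?U = "topspace (labelled_space n (simplex_bd n d))"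
  have "finite (carrier (sym_group n))"
    by (simp add: sym_group_def finite_permutations)
  then have "compact_space ?T"
    using compact_space_circle_times[of n]
    by (simp add: compact_space_prod_topology compact_space_discrete_topology)
  moreover have "Hausdorff_space ?P"
    by (simp add: Hausdorff_space_product_topology Hausdorff_space_subtopology)
  ultimately have "closed_map ?T ?P (labelled_pts n)"
    by (intro continuous_imp_closed_map continuous_map_labelled_pts)
  moreover have U: "{q \<in> topspace ?T. labelled_pts n q \<in> {x. mult_le d n x}} = ?U"
    using labelled_pts_mult_le_iff[OF _ assms] simplex_bd_subset[of n d]
    unfolding topspace_labelled_space[OF order_refl] topspace_labelled_space[OF simplex_bd_subset]
    by auto
  ultimately have closed: "closed_map (subtopology ?T ?U) (mult_space d circle n) (labelled_pts n)"
    unfolding mult_space_eq by (rule closed_map_restriction)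
  \<comment> \<open>The restricted closed map lives on a subspace of the compact space; this
    identifies its topology with that of the labelled space over
    \<open>simplex_bd n d\<close>.\<close>
  have "circle_times n (simplex_bd n d) =
      subtopology (circle_times n (std_simplex n)) (UNIV \<times> simplex_bd n d)"
    using simplex_bd_subset[of n d]
    by (simp add: circle_times_def subtopology_Times subtopology_subtopology Int_absorb1 inf.absorb2)
  then have T: "labelled_space n (simplex_bd n d) = subtopology ?T ((UNIV \<times> simplex_bd n d) \<times> UNIV)"
    by (simp add: subtopology_Times)
  also have "\<dots> = subtopology ?T ?U"
    unfolding T topspace_subtopology by (rule subtopology_restrict[symmetric])
  finally have T: "labelled_space n (simplex_bd n d) = subtopology ?T ?U" .
  have img: "labelled_pts n ` ?U = topspace (mult_space d circle n)"
  proof -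
    have "labelled_pts n q \<in> {1..n} \<rightarrow>\<^sub>E sphere 0 1" if "q \<in> topspace ?T" for q
      using continuous_map_labelled_pts[of n "std_simplex n"] that
      by (auto simp: continuous_map_def simp del: topspace_prod_topology)
    then show ?thesis
      unfolding topspace_mult_space U[symmetric]
      using labelled_pts_surj[OF \<open>n \<ge> 1\<close>] by (fastforce simp del: topspace_prod_topology)
  qed
  have "continuous_map (labelled_space n (simplex_bd n d)) (mult_space d circle n) (labelled_pts n)"
    unfolding mult_space_eq continuous_map_in_subtopology
    using continuous_map_labelled_pts U by blast
  then show ?thesis
    using closed[folded T] img by (rule continuous_closed_imp_quotient_map)
qed

section \<open>Comparison of the quotients\<close>

text \<open>Rotating the list is compensated by precomposing the label with the same power of the
  cycle. Hence \<open>labelled_pts\<close> is constant on orbits of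
  \<open>tau_twisted\<close>.\<close>

lemma circle_pts_tau_perm_act:
  assumes "p \<in> sphere 0 1 \<times> std_simplex n" "\<sigma> permutes {1..n}"
  shows "perm_act n (\<sigma> \<circ> (cyc n ^^ k)) (circle_pts n ((tau n ^^ k) p)) = perm_act n \<sigma> (circle_pts n p)"
proof -
  have ck: "(cyc n ^^ k) permutes {1..n}"
    by (rule permutes_funpow[OF cyc_permutes])
  have "perm_act n (cyc n ^^ k) (circle_pts n ((tau n ^^ k) p)) = circle_pts n p"
    using circle_pts_tau_funpow[OF assms(1)] by (subst perm_act_eq_iff[OF ck])
      (auto simp: circle_pts_def case_prod_beta')
  then show ?thesis
    by (simp add: perm_act_comp[OF assms(2) ck, symmetric])
qed

text \<open>Both orbit relations are reduced to one statement: \<open>q\<close> is an iterate of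
  \<open>tau\<close> applied to \<open>p\<close>.\<close>

lemma orbit_circle_pts_eq_iff:
  assumes n: "n \<ge> 1" "d \<ge> 1"
    and p: "p \<in> sphere 0 1 \<times> simplex_bd n d" and q: "q \<in> sphere 0 1 \<times> simplex_bd n d"
  shows "orbit (sym_group n) (perm_act n) (circle_pts n p) =
         orbit (sym_group n) (perm_act n) (circle_pts n q) \<longleftrightarrow>
         orbit (integer_mod_group n) (cyclic_act (tau n)) p =
         orbit (integer_mod_group n) (cyclic_act (tau n)) q"
proof -
  have p': "p \<in> sphere 0 1 \<times> std_simplex n" and q': "q \<in> sphere 0 1 \<times> std_simplex n"
    using p q simplex_bd_subset by blast+
  have mem: "circle_pts n u \<in> topspace (mult_space d circle n)" if "u \<in> sphere 0 1 \<times> simplex_bd n d" for u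
    unfolding topspace_mult_space
    using circle_pts_PiE[OF that] mult_le_circle_pts[OF that n] by simp
  have E: "topspace (circle_times n (simplex_bd n d)) = sphere 0 1 \<times> simplex_bd n d"
    by (rule topspace_circle_times[OF simplex_bd_subset])
  have "orbit (sym_group n) (perm_act n) (circle_pts n p) =
        orbit (sym_group n) (perm_act n) (circle_pts n q) \<longleftrightarrow>
      (\<exists>\<sigma>. \<sigma> permutes {1..n} \<and> circle_pts n q = perm_act n \<sigma> (circle_pts n p))"
    using orbit_eq_iff[OF group_action_perm_act mem[OF p] mem[OF q]] by (auto simp: sym_group_carrier)
  also have "\<dots> \<longleftrightarrow> (\<exists>k. q = (tau n ^^ k) p)"
  proof
    assume "\<exists>\<sigma>. \<sigma> permutes {1..n} \<and> circle_pts n q = perm_act n \<sigma> (circle_pts n p)"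
    then obtain \<sigma> where \<sigma>: "\<sigma> permutes {1..n}" "circle_pts n q = perm_act n \<sigma> (circle_pts n p)"
      by blast
    have "circle_pts n p (inv' \<sigma> i) = circle_pts n q i" if "i \<in> {1..n}" for i
      using that by (simp add: \<sigma>(2) perm_act_inv[OF \<sigma>(1)] del: atLeastAtMost_iff)
    then show "\<exists>k. q = (tau n ^^ k) p"
      by (rule circle_pts_eq_imp_tau[OF p' q' n(1) permutes_inv[OF \<sigma>(1)]])
  next
    assume "\<exists>k. q = (tau n ^^ k) p"
    then obtain k where k: "q = (tau n ^^ k) p" ..
    have ck: "(cyc n ^^ k) permutes {1..n}"
      by (rule permutes_funpow[OF cyc_permutes])
    \<comment> \<open>Taking the inverse of the cycle power as label makes the composite label the
      identity.\<close>
    have "circle_pts n q = perm_act n (inv' (cyc n ^^ k)) (circle_pts n p)"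
      using circle_pts_tau_perm_act[OF p' permutes_inv[OF ck], of k] circle_pts_PiE[OF q', of n]
      unfolding k permutes_inv_o(2)[OF ck]
      by (simp add: perm_act_def PiE_def extensional_restrict sym_group_carrier permutes_id)
    then show "\<exists>\<sigma>. \<sigma> permutes {1..n} \<and> circle_pts n q = perm_act n \<sigma> (circle_pts n p)"
      using permutes_inv[OF ck] by blast
  qed
  also have "\<dots> \<longleftrightarrow> (\<exists>k\<in>carrier (integer_mod_group n). q = cyclic_act (tau n) k p)"
    by (rule cyclic_act_orbit_iff[where t = "tau n", OF n(1) tau_funpow_n[OF p' n(1)], symmetric])
  also have "\<dots> \<longleftrightarrow> orbit (integer_mod_group n) (cyclic_act (tau n)) p =
      orbit (integer_mod_group n) (cyclic_act (tau n)) q"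
    by (rule orbit_eq_iff[OF group_action_tau[OF n(1), of d], unfolded E, OF p q, symmetric])
  finally show ?thesis .
qed

section \<open>Fibres of the labelled map on distinct points\<close>

lemma tau_twisted_funpow:
  "(tau_twisted n ^^ k) (p, \<sigma>) = ((tau n ^^ k) p, \<sigma> \<circ> (cyc n ^^ k))"
  by (induction k) (auto simp: tau_twisted_def fun_eq_iff funpow_swap1)

text \<open>Equal labelled tuples come from pairs related by a power of \<open>tau\<close>. Over the
  open simplex the points are distinct, so freeness of the permutation action forces the labels to
  differ by the same power of the cycle.\<close>

lemma labelled_pts_eq_iff:
  assumes n: "n \<ge> 1"
    and u: "u \<in> topspace (labelled_space n (open_simplex n))"
    and v: "v \<in> topspace (labelled_space n (open_simplex n))"
  shows "labelled_pts n u = labelled_pts n v \<longleftrightarrow>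
         orbit (integer_mod_group n) (cyclic_act (tau_twisted n)) u =
         orbit (integer_mod_group n) (cyclic_act (tau_twisted n)) v"
proof -
  have sub: "open_simplex n \<subseteq> std_simplex n"
    by (auto simp: open_simplex_def)
  obtain p \<sigma> where u': "u = (p, \<sigma>)" "p \<in> sphere 0 1 \<times> open_simplex n" "\<sigma> permutes {1..n}"
    using u unfolding topspace_labelled_space[OF sub] by auto
  obtain q \<rho> where v': "v = (q, \<rho>)" "q \<in> sphere 0 1 \<times> open_simplex n" "\<rho> permutes {1..n}"
    using v unfolding topspace_labelled_space[OF sub] by auto
  have p: "p \<in> sphere 0 1 \<times> std_simplex n" and q: "q \<in> sphere 0 1 \<times> std_simplex n"
    using u' v' sub by blast+
  have "labelled_pts n u = labelled_pts n v \<longleftrightarrow> (\<exists>k. v = (tau_twisted n ^^ k) u)"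
  proof
    assume eq: "labelled_pts n u = labelled_pts n v"
    then have eq': "perm_act n \<sigma> (circle_pts n p) = perm_act n \<rho> (circle_pts n q)"
      by (simp add: u' v' labelled_pts_def)
    \<comment> \<open>Comparing the two labellings matches the cyclic list of \<open>q\<close> with
      that of \<open>p\<close>.\<close>
    define \<pi> where "\<pi> = inv' \<sigma> \<circ> \<rho>"
    have \<pi>: "\<pi> permutes {1..n}"
      unfolding \<pi>_def by (intro permutes_compose permutes_inv u'(3) v'(3))
    have "circle_pts n p (\<pi> i) = circle_pts n q i" if i: "i \<in> {1..n}" for i
    proof -
      have "\<pi> i \<in> {1..n}"
        using permutes_in_image[OF \<pi>] i by blast
      from perm_act_apply[OF u'(3) this, of "circle_pts n p"] show ?thesis
        using perm_act_apply[OF v'(3) i, of "circle_pts n q"]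
        by (simp add: eq' \<pi>_def permutes_inverses(1)[OF u'(3)])
    qed
    from circle_pts_eq_imp_tau[OF p q n \<pi> this] obtain k where k: "q = (tau n ^^ k) p"
      by blast
    have ck: "(cyc n ^^ k) permutes {1..n}"
      by (rule permutes_funpow[OF cyc_permutes])
    have "perm_act n \<rho> (circle_pts n q) = perm_act n (\<sigma> \<circ> (cyc n ^^ k)) (circle_pts n q)"
      using circle_pts_tau_perm_act[OF p u'(3), of k] by (simp add: eq' k)
    moreover have "inj_on (circle_pts n q) {1..n}"
    proof -
      have q1: "q \<in> sphere 0 1 \<times> simplex_bd n 1"
        using v'(2) by (simp only: simplex_bd_1)
      have "circle_pts n q \<in> topspace (conf_space circle n)"
        unfolding topspace_mult_space
        using circle_pts_PiE[OF q1] mult_le_circle_pts[OF q1 n order_refl] by simp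
      then show ?thesis
        unfolding topspace_conf_space by blast
    qed
    ultimately have "\<rho> = \<sigma> \<circ> (cyc n ^^ k)"
      by (intro perm_act_cancel[OF v'(3) permutes_compose[OF ck u'(3)]])
    then show "\<exists>k. v = (tau_twisted n ^^ k) u"
      using k by (auto simp: u'(1) v'(1) tau_twisted_funpow)
  next
    assume "\<exists>k. v = (tau_twisted n ^^ k) u"
    then show "labelled_pts n u = labelled_pts n v"
      using circle_pts_tau_perm_act[OF p u'(3)] by (auto simp: u'(1) tau_twisted_funpow labelled_pts_def)
  qed
  also have "\<dots> \<longleftrightarrow> (\<exists>k\<in>carrier (integer_mod_group n). v = cyclic_act (tau_twisted n) k u)"
    by (rule cyclic_act_orbit_iff[where t = "tau_twisted n", OF n, symmetric])
      (simp add: u'(1) tau_twisted_funpow tau_funpow_n[OF p n] cyc_funpow_n)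
  also have "\<dots> \<longleftrightarrow> orbit (integer_mod_group n) (cyclic_act (tau_twisted n)) u =
      orbit (integer_mod_group n) (cyclic_act (tau_twisted n)) v"
    by (rule orbit_eq_iff[OF group_action_tau_twisted[OF n] u v, symmetric])
  finally show ?thesis .
qed

section \<open>Unordered configurations as a quotient\<close>

lemma orbit_perm_act_self:
  assumes "x \<in> topspace (mult_space d X n)" "\<sigma> permutes {1..n}"
  shows "orbit (sym_group n) (perm_act n) (perm_act n \<sigma> x) = orbit (sym_group n) (perm_act n) x"
proof -
  have \<sigma>: "\<sigma> \<in> carrier (sym_group n)"
    using assms(2) by (simp add: sym_group_carrier)
  have "perm_act n \<sigma> x \<in> topspace (mult_space d X n)"
    using group_action.element_image[OF group_action_perm_act \<sigma> assms(1) refl] assms(1) by simp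
  from orbit_eq_iff[OF group_action_perm_act assms(1) this] show ?thesis
    using \<sigma> by blast
qed

text \<open>Passing to permutation orbits erases the label, so the labelled quotient map followed by
  the orbit map factors through the projection \<open>fst\<close>. As \<open>fst\<close> is itself a
  quotient map, so is the remaining factor.\<close>

lemma quotient_map_circle_pts_orbit:
  assumes n: "n \<ge> 1" "d \<ge> 1"
  shows "quotient_map (circle_times n (simplex_bd n d)) (unordered_mult_space d circle n)
    (orbit (sym_group n) (perm_act n) \<circ> circle_pts n)"
proof -
  let ?X = "circle_times n (simplex_bd n d)"
  let ?orb = "orbit (sym_group n) (perm_act n)"
  have E: "topspace ?X = sphere 0 1 \<times> simplex_bd n d"
    by (rule topspace_circle_times[OF simplex_bd_subset])
  have mem: "circle_pts n p \<in> topspace (mult_space d circle n)" if "p \<in> topspace ?X" for p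
    unfolding topspace_mult_space
    using circle_pts_PiE[of p "simplex_bd n d" n] mult_le_circle_pts[OF _ n] that by (simp add: E)
  have orb: "quotient_map (mult_space d circle n) (unordered_mult_space d circle n) ?orb"
    unfolding unordered_mult_space_def by (rule quotient_map_orbit_space)
  have "quotient_map (labelled_space n (simplex_bd n d)) (unordered_mult_space d circle n)
      (?orb \<circ> labelled_pts n)"
    using quotient_map_compose[OF quotient_map_labelled_pts[OF n] orb] .
  then have "quotient_map (labelled_space n (simplex_bd n d)) (unordered_mult_space d circle n)
      ((?orb \<circ> circle_pts n) \<circ> fst)"
  proof (rule quotient_map_eq)
    fix u assume "u \<in> topspace (labelled_space n (simplex_bd n d))"
    then show "(?orb \<circ> labelled_pts n) u = (?orb \<circ> circle_pts n \<circ> fst) u"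
      using mem[of "fst u"] orbit_perm_act_self[of "circle_pts n (fst u)" d circle n "snd u"]
      by (auto simp: labelled_pts_def sym_group_carrier case_prod_beta')
  qed
  moreover have "quotient_map (labelled_space n (simplex_bd n d)) ?X fst"
  proof -
    \<comment> \<open>The projection is onto because there is at least one label.\<close>
    have "id \<in> carrier (sym_group n)"
      by (simp add: sym_group_carrier permutes_id)
    then have "discrete_topology (carrier (sym_group n)) \<noteq> trivial_topology"
      by (metis empty_iff topspace_discrete_topology)
    then show ?thesis
      by simp
  qed
  ultimately show ?thesis
    by (simp only: quotient_map_compose_eq)
qed

theorem proposition3p1:
  fixes n d :: nat
  assumes "n \<ge> 1" and "d \<ge> 1"
  shows "orbit_space (integer_mod_group n) (cyclic_act (tau n)) (circle_times n (simplex_bd n d))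
           homeomorphic_space unordered_mult_space d circle n
       \<and> (d = 1 \<longrightarrow>
           (\<exists>f. homeomorphic_map (conf_space circle n) (induced_space n) f \<and>
                (\<forall>g \<in> carrier (sym_group n). \<forall>x \<in> topspace (conf_space circle n).
                   f (perm_act n g x) = left_act g (f x))))"
proof (intro conjI impI)
  let ?X = "circle_times n (simplex_bd n d)"
  have E: "topspace ?X = sphere 0 1 \<times> simplex_bd n d"
    by (rule topspace_circle_times[OF simplex_bd_subset])
  obtain h where "homeomorphic_map (orbit_space (integer_mod_group n) (cyclic_act (tau n)) ?X)
      (unordered_mult_space d circle n) h"
  proof (rule homeomorphic_map_quotient_maps[OF quotient_map_orbit_space
        quotient_map_circle_pts_orbit[OF assms]])
    fix p q assume "p \<in> topspace ?X" "q \<in> topspace ?X"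
    then show "orbit (integer_mod_group n) (cyclic_act (tau n)) p =
        orbit (integer_mod_group n) (cyclic_act (tau n)) q \<longleftrightarrow>
        (orbit (sym_group n) (perm_act n) \<circ> circle_pts n) p =
        (orbit (sym_group n) (perm_act n) \<circ> circle_pts n) q"
      using orbit_circle_pts_eq_iff[OF assms, of p q] by (simp add: E)
  qed
  then show "orbit_space (integer_mod_group n) (cyclic_act (tau n)) ?X
      homeomorphic_space unordered_mult_space d circle n"
    using homeomorphic_map_imp_homeomorphic_space by blast
next
  let ?L = "labelled_space n (open_simplex n)"
  let ?orb = "orbit (integer_mod_group n) (cyclic_act (tau_twisted n))"
  have L: "quotient_map ?L (conf_space circle n) (labelled_pts n)"
    using quotient_map_labelled_pts[OF assms(1) order_refl] unfolding simplex_bd_1 .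
  have "quotient_map ?L (induced_space n) ?orb"
    unfolding induced_space_def by (rule quotient_map_orbit_space)
  from homeomorphic_map_quotient_maps[OF L this labelled_pts_eq_iff[OF assms(1)]]
  obtain f where f: "homeomorphic_map (conf_space circle n) (induced_space n) f"
    and f_eq: "\<And>u. u \<in> topspace ?L \<Longrightarrow> f (labelled_pts n u) = ?orb u"
    by blast
  have "f (perm_act n g x) = left_act g (f x)"
    if g: "g \<in> carrier (sym_group n)" and x: "x \<in> topspace (conf_space circle n)" for g x
  proof -
    have sub: "open_simplex n \<subseteq> std_simplex n"
      by (auto simp: open_simplex_def)
    have gp: "g permutes {1..n}"
      using g by (simp add: sym_group_carrier)
    \<comment> \<open>Equivariance is checked on a representative: permuting the tuple by
      \<open>g\<close> and \<open>left_act g\<close> both replace its label \<sigma> by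
      \<open>g \<circ> \<sigma>\<close>.\<close>
    obtain u where u: "u \<in> topspace ?L" "x = labelled_pts n u"
      using x quotient_imp_surjective_map[OF L] by blast
    then obtain p \<sigma> where p: "u = (p, \<sigma>)" "p \<in> sphere 0 1 \<times> open_simplex n" "\<sigma> permutes {1..n}"
      unfolding topspace_labelled_space[OF sub] by auto
    have "(p, g \<circ> \<sigma>) \<in> topspace ?L"
      unfolding topspace_labelled_space[OF sub] using p permutes_compose[OF p(3) gp] by blast
    moreover have "perm_act n g x = labelled_pts n (p, g \<circ> \<sigma>)"
      by (simp add: u(2) p(1) labelled_pts_def perm_act_comp[OF gp p(3)])
    ultimately show ?thesis
      using f_eq[OF u(1)] f_eq[of "(p, g \<circ> \<sigma>)"] by (simp only: u(2) p(1) left_act_orbit)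
  qed
  with f show "\<exists>f. homeomorphic_map (conf_space circle n) (induced_space n) f \<and>
      (\<forall>g \<in> carrier (sym_group n). \<forall>x \<in> topspace (conf_space circle n).
         f (perm_act n g x) = left_act g (f x))"
    by blast
qed

end
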